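(* Let $\Gamma$ be a bridgeless metrized graph with edges $e_1,\dots,e_e$ and genus $g$. Then $$\tau(\Gamma)=\frac1{g+1}\sum_{i=1}^e\frac{L_i}{L_i+R_i}\tau(\Gamma-e_i)+\frac{\ell(\Gamma)}{6(g+1)}-\frac{r(\Gamma)}{4(g+1)}.$$
   Context: A metrized graph is a finite connected graph (multiple edges and self-loops allowed) whose edges $e_i$ are identified with closed segments of lengths $L_i>0$; its vertex set is finite, nonempty and contains all points of valence $\neq2$; $g=e-v+1$ with $e,v$ the numbers of edges and vertices; $\ell(\Gamma)=\sum L_i$. $\Gamma-e_i$ is $\Gamma$ with the interior of $e_i$ removed; $\Gamma$ is bridgeless if every $\Gamma-e_i$ is connected. $R_i$ is the effective resistance between the endpoints of $e_i$ in $\Gamma-e_i$ (edges viewed as resistors with resistance equal to length). $r(\Gamma)=\sum_{e_i}\frac{L_iR_i}{L_i+R_i}$. With $r(x,y)$ the effective resistance, $\tau(\Gamma)=\frac14\int_\Gamma(\frac{\partial}{\partial x}r(x,y))^2dx$ (independent of $y$). *)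

theory Defs
  imports "HOL-Analysis.Analysis" "Graph_Theory.Graph_Theory"
begin

text \<open>
  A metrized graph is given by a finite connected multigraph \<open>G\<close> (multiple edges and self-loops
  allowed) with edge lengths \<open>L\<close>. The direction of an arc \<open>a\<close> has no meaning of its own: it
  only fixes the identification of the edge with the segment from \<open>0\<close> (at the tail) to \<open>L a\<close>
  (at the head). Interior points of edges have valence 2, so all other valences occur at vertices.
  \<open>Digraph_Component.connected\<close> is weak connectedness and includes that there is a vertex; it is
  qualified because \<open>HOL-Analysis\<close> has a topological notion of the same name.
\<close>

locale metrized_graph = fin_digraph G
  for G :: "('v, 'e) pre_digraph" (structure) +
  fixes L :: "'e \<Rightarrow> real"
  assumes connected: "Digraph_Component.connected G"
    and length_pos: "a \<in> arcs G \<Longrightarrow> L a > 0"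

text \<open>\<open>pre_digraph.del_arc G a\<close> is the graph with the interior of the edge \<open>a\<close> removed.\<close>

definition bridgeless :: "('v, 'e) pre_digraph \<Rightarrow> bool" where
  "bridgeless G \<longleftrightarrow> (\<forall>a \<in> arcs G. Digraph_Component.connected (pre_digraph.del_arc G a))"

definition genus :: "('v, 'e) pre_digraph \<Rightarrow> int" where
  "genus G = int (card (arcs G)) - int (card (verts G)) + 1"

definition total_length :: "('v, 'e) pre_digraph \<Rightarrow> ('e \<Rightarrow> real) \<Rightarrow> real" where
  "total_length G L = (\<Sum>a \<in> arcs G. L a)"

text \<open>
  Effective resistance of a network in which the arc \<open>a\<close> is a resistor of resistance \<open>R a\<close>:
  the potential drop from \<open>p\<close> to \<open>q\<close> when a unit current enters at \<open>p\<close> and leaves at \<open>q\<close>. By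
  Ohm's law the current along \<open>a\<close> out of its tail is \<open>(f (tail G a) - f (head G a)) / R a\<close>, and
  Kirchhoff's current law gives the net current out of each vertex.
\<close>

definition unit_current_potential ::
    "('v, 'e) pre_digraph \<Rightarrow> ('e \<Rightarrow> real) \<Rightarrow> 'v \<Rightarrow> 'v \<Rightarrow> ('v \<Rightarrow> real) \<Rightarrow> bool" where
  "unit_current_potential G R p q f \<longleftrightarrow>
     (\<forall>v \<in> verts G.
        (\<Sum>a \<in> out_arcs G v. (f v - f (head G a)) / R a)
        + (\<Sum>a \<in> in_arcs G v. (f v - f (tail G a)) / R a)
        = (if v = p then 1 else 0) - (if v = q then 1 else 0))"

definition eff_resistance ::
    "('v, 'e) pre_digraph \<Rightarrow> ('e \<Rightarrow> real) \<Rightarrow> 'v \<Rightarrow> 'v \<Rightarrow> real" where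
  "eff_resistance G R p q =
     (THE r. \<exists>f. unit_current_potential G R p q f \<and> r = f p - f q)"

text \<open>The points of a metrized graph; \<open>Inner a t\<close> is the point of the edge \<open>a\<close> at distance
  \<open>t\<close> along the edge from its tail, with \<open>0 < t < L a\<close>.\<close>

datatype ('v, 'e) point = Vertex 'v | Inner 'e real

definition points :: "('v, 'e) pre_digraph \<Rightarrow> ('e \<Rightarrow> real) \<Rightarrow> ('v, 'e) point set" where
  "points G L = Vertex ` verts G \<union> {Inner a t | a t. a \<in> arcs G \<and> 0 < t \<and> t < L a}"

definition edge_point ::
    "('v, 'e) pre_digraph \<Rightarrow> ('e \<Rightarrow> real) \<Rightarrow> 'e \<Rightarrow> real \<Rightarrow> ('v, 'e) point" where
  "edge_point G L a t =
     (if t \<le> 0 then Vertex (tail G a)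
      else if t \<ge> L a then Vertex (head G a)
      else Inner a t)"

text \<open>
  Enlarging the vertex set by a finite set \<open>P\<close> of points: each edge \<open>a\<close> is cut at the points of
  \<open>P\<close> in its interior, and an arc \<open>(a, s, t)\<close> of the refined graph is the part of \<open>a\<close> between
  two consecutive cut points, of length \<open>t - s\<close>.
\<close>

definition cuts :: "('e \<Rightarrow> real) \<Rightarrow> ('v, 'e) point set \<Rightarrow> 'e \<Rightarrow> real set" where
  "cuts L P a = {0, L a} \<union> {t. Inner a t \<in> P}"

definition refine ::
    "('v, 'e) pre_digraph \<Rightarrow> ('e \<Rightarrow> real) \<Rightarrow> ('v, 'e) point set
      \<Rightarrow> (('v, 'e) point, 'e \<times> real \<times> real) pre_digraph" where
  "refine G L P =
     \<lparr>verts = Vertex ` verts G \<union> P,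
      arcs = {(a, s, t). a \<in> arcs G \<and> s \<in> cuts L P a \<and> t \<in> cuts L P a \<and> s < t
                \<and> (\<forall>u \<in> cuts L P a. \<not> (s < u \<and> u < t))},
      tail = (\<lambda>(a, s, t). edge_point G L a s),
      head = (\<lambda>(a, s, t). edge_point G L a t)\<rparr>"

text \<open>The resistance function \<open>r(x, y)\<close> on arbitrary points of the metrized graph.\<close>

definition resistance ::
    "('v, 'e) pre_digraph \<Rightarrow> ('e \<Rightarrow> real) \<Rightarrow> ('v, 'e) point \<Rightarrow> ('v, 'e) point \<Rightarrow> real" where
  "resistance G L x y =
     eff_resistance (refine G L {x, y}) (\<lambda>(a, s, t). t - s) x y"

text \<open>
  \<open>r(x, y)\<close> need not be differentiable in \<open>x\<close> at vertices and at \<open>y\<close>; these are finitely many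
  points and do not affect the integral. The integral does not depend on \<open>y\<close>, and the tau
  constant is its common value.
\<close>

definition tau_at ::
    "('v, 'e) pre_digraph \<Rightarrow> ('e \<Rightarrow> real) \<Rightarrow> ('v, 'e) point \<Rightarrow> real" where
  "tau_at G L y =
     1 / 4 * (\<Sum>a \<in> arcs G.
       integral {0..L a} (\<lambda>t. (deriv (\<lambda>s. resistance G L (edge_point G L a s) y) t)\<^sup>2))"

definition tau :: "('v, 'e) pre_digraph \<Rightarrow> ('e \<Rightarrow> real) \<Rightarrow> real" where
  "tau G L = (THE c. \<forall>y \<in> points G L. tau_at G L y = c)"

text \<open>The resistance \<open>R\<^sub>i\<close> between the endpoints of an edge in the graph without that edge.\<close>

definition edge_R :: "('v, 'e) pre_digraph \<Rightarrow> ('e \<Rightarrow> real) \<Rightarrow> 'e \<Rightarrow> real" where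
  "edge_R G L a = eff_resistance (pre_digraph.del_arc G a) L (tail G a) (head G a)"

definition r_const :: "('v, 'e) pre_digraph \<Rightarrow> ('e \<Rightarrow> real) \<Rightarrow> real" where
  "r_const G L = (\<Sum>a \<in> arcs G. L a * edge_R G L a / (L a + edge_R G L a))"

end

(*
  Let g(x, y) be the Green function of the network grounded at a vertex p. Interpolating g linearly
  along the edges and adding on each edge the Green function min s t - s t / L of a segment gives
  r(x, y) = g(x, x) + g(y, y) - 2 g(x, y) for all points. On every edge r(x, p) is then quadratic in
  x, and integration yields tau as a finite sum over the edges in terms of the matrix
  T e f = (potential drop along f of a unit dipole at e) and the drops of r(., p). Replacing p by
  an arbitrary point y does not change the sum: this is a summation by parts.

  Deleting the edge e is a rank-one perturbation of the Laplacian: with j_e the dipole potential of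
  e, g becomes g + j_e j_e / (L_e - T e e), and L_e / (L_e + R_e) = (L_e - T e e) / L_e. Expanding
  the weighted sum of the tau constants of the deleted graphs, the terms are evaluated by Foster's
  theorem (giving the genus), by the fact that L - T is up to scaling an orthogonal projection, and
  by testing the dipole current of e against the cube of its own potential j_e.
*)
theory Submission
  imports Defs
begin

section \<open>Gaussian elimination over a field\<close>

section \<open>Linear systems\<close>

text \<open>Induction on the equations. A nonzero coefficient of the new equation serves as pivot:
  its unknown is eliminated from the other equations, and its value is recovered at the end from the
  new one.\<close>

lemma underdetermined_system_nontrivial:
  fixes A :: "'i \<Rightarrow> 'j \<Rightarrow> 'a::field"
  assumes "finite I" "finite J" "card I < card J"
  shows "\<exists>x. (\<exists>j\<in>J. x j \<noteq> 0) \<and> (\<forall>i\<in>I. (\<Sum>j\<in>J. A i j * x j) = 0)"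
  using assms
proof (induction I arbitrary: A J rule: finite_induct)
  case empty
  then obtain j where "j \<in> J" by fastforce
  then show ?case by (intro exI[of _ "\<lambda>_. 1"]) auto
next
  case (insert i I)
  show ?case
  proof (cases "\<forall>j\<in>J. A i j = 0")
    case True
    have "card I < card J" using insert by simp
    from insert.IH[OF \<open>finite J\<close> this, of A] obtain x where
      "\<exists>j\<in>J. x j \<noteq> 0" "\<forall>i\<in>I. (\<Sum>j\<in>J. A i j * x j) = 0" by blast
    with True show ?thesis by (intro exI[of _ x]) auto
  next
    case False
    then obtain k where k: "k \<in> J" "A i k \<noteq> 0" by blast
    define J' where "J' = J - {k}"
    have J': "finite J'" "card I < card J'" "k \<notin> J'" "J = insert k J'"
      using insert k by (auto simp: J'_def)
    from insert.IH[OF J'(1,2), of "\<lambda>i' j. A i' j - A i' k * A i j / A i k"] obtain x where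
      x: "\<exists>j\<in>J'. x j \<noteq> 0"
         "\<And>i'. i' \<in> I \<Longrightarrow> (\<Sum>j\<in>J'. (A i' j - A i' k * A i j / A i k) * x j) = 0" by blast
    define c where "c = - (\<Sum>j\<in>J'. A i j * x j) / A i k"
    define y where "y = x(k := c)"
    have sum_y: "(\<Sum>j\<in>J. A i' j * y j) = A i' k * c + (\<Sum>j\<in>J'. A i' j * x j)" for i'
    proof -
      have "(\<Sum>j\<in>J'. A i' j * y j) = (\<Sum>j\<in>J'. A i' j * x j)"
        using J'(3) by (intro sum.cong) (auto simp: y_def)
      then show ?thesis using J' by (simp add: y_def)
    qed
    have "(\<Sum>j\<in>J. A i' j * y j) = 0" if "i' \<in> I" for i'
    proof -
      have "(\<Sum>j\<in>J'. (A i' j - A i' k * A i j / A i k) * x j)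
          = (\<Sum>j\<in>J'. A i' j * x j) - (A i' k / A i k) * (\<Sum>j\<in>J'. A i j * x j)"
        by (simp add: sum_subtractf sum_distrib_left algebra_simps)
      with x(2)[OF that] show ?thesis by (simp add: sum_y c_def)
    qed
    moreover have "(\<Sum>j\<in>J. A i j * y j) = 0"
      using k by (simp add: sum_y c_def)
    moreover have "\<exists>j\<in>J. y j \<noteq> 0"
      using x(1) J'(3,4) by (auto simp: y_def)
    ultimately show ?thesis by blast
  qed
qed

text \<open>Adjoining \<open>b\<close> as an extra column, indexed by \<open>None\<close>, gives
  more unknowns than equations. Injectivity forces the \<open>None\<close> entry of a nontrivial
  kernel vector to be nonzero, and rescaling that entry to -1 yields a solution.\<close>

lemma injective_square_system_solvable:
  fixes A :: "'i \<Rightarrow> 'i \<Rightarrow> 'a::field"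
  assumes "finite I"
    and inj: "\<And>x. (\<And>i. i \<in> I \<Longrightarrow> (\<Sum>j\<in>I. A i j * x j) = 0) \<Longrightarrow> \<forall>j\<in>I. x j = 0"
  shows "\<exists>x. \<forall>i\<in>I. (\<Sum>j\<in>I. A i j * x j) = b i"
proof -
  define J where "J = insert None (Some ` I)"
  define A' where "A' i j = (case j of None \<Rightarrow> b i | Some j \<Rightarrow> A i j)" for i j
  have "finite J" "card I < card J"
    using assms(1) by (auto simp: J_def card_image)
  from underdetermined_system_nontrivial[OF assms(1) this, of A'] obtain x where
    x: "\<exists>j\<in>J. x j \<noteq> 0" "\<And>i. i \<in> I \<Longrightarrow> (\<Sum>j\<in>J. A' i j * x j) = 0" by blast
  have sum_J: "b i * x None + (\<Sum>j\<in>I. A i j * x (Some j)) = 0" if "i \<in> I" for i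
    using x(2)[OF that] assms(1) by (simp add: J_def A'_def sum.reindex)
  have "x None \<noteq> 0"
  proof
    assume "x None = 0"
    with sum_J inj[of "\<lambda>j. x (Some j)"] x(1) show False by (auto simp: J_def)
  qed
  then show ?thesis
  proof (intro exI[of _ "\<lambda>j. - x (Some j) / x None"] ballI)
    fix i assume "i \<in> I"
    have "(\<Sum>j\<in>I. A i j * (- x (Some j) / x None)) = - (\<Sum>j\<in>I. A i j * x (Some j)) / x None"
      by (simp add: sum_negf sum_divide_distrib)
    then show "(\<Sum>j\<in>I. A i j * (- x (Some j) / x None)) = b i"
      using sum_J[OF \<open>i \<in> I\<close>] \<open>x None \<noteq> 0\<close> by (simp add: field_simps add_eq_0_iff)
  qed
qed

section \<open>Kirchhoff's laws in weak form, and the grounded Green function\<close>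

section \<open>Electrical networks\<close>

definition vdrop :: "('v, 'e) pre_digraph \<Rightarrow> 'e \<Rightarrow> ('v \<Rightarrow> real) \<Rightarrow> real" where
  "vdrop G a f = f (tail G a) - f (head G a)"

text \<open>The energy form of the network. Working with it instead of the Laplacian matrix turns
  every potential equation into a statement about all test functions \<open>h\<close>.\<close>

definition dirichlet ::
    "('v, 'e) pre_digraph \<Rightarrow> ('e \<Rightarrow> real) \<Rightarrow> ('v \<Rightarrow> real) \<Rightarrow> ('v \<Rightarrow> real) \<Rightarrow> real" where
  "dirichlet G R f h = (\<Sum>a\<in>arcs G. vdrop G a f * vdrop G a h / R a)"

lemma vdrop_add: "vdrop G a (\<lambda>v. f v + f' v) = vdrop G a f + vdrop G a f'"
  and vdrop_diff: "vdrop G a (\<lambda>v. f v - f' v) = vdrop G a f - vdrop G a f'"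
  and vdrop_cmult: "vdrop G a (\<lambda>v. c * f v) = c * vdrop G a f"
  and vdrop_const: "vdrop G a (\<lambda>v. c) = 0"
  by (simp_all add: vdrop_def algebra_simps)

lemma dirichlet_commute: "dirichlet G R f h = dirichlet G R h f"
  by (simp add: dirichlet_def mult.commute)

lemma dirichlet_add: "dirichlet G R (\<lambda>v. f v + f' v) h = dirichlet G R f h + dirichlet G R f' h"
  by (simp add: dirichlet_def vdrop_add distrib_right add_divide_distrib sum.distrib)

lemma dirichlet_diff: "dirichlet G R (\<lambda>v. f v - f' v) h = dirichlet G R f h - dirichlet G R f' h"
  by (simp add: dirichlet_def vdrop_diff left_diff_distrib diff_divide_distrib sum_subtractf)

lemma dirichlet_cmult: "dirichlet G R (\<lambda>v. c * f v) h = c * dirichlet G R f h"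
  by (simp add: dirichlet_def vdrop_cmult sum_distrib_left mult.assoc)

lemma sum_mult_of_bool_pick:
  fixes f :: "'v \<Rightarrow> real"
  assumes "finite A" "u \<in> A"
  shows "(\<Sum>v\<in>A. f v * of_bool (u = v)) = f u" "(\<Sum>v\<in>A. f v * of_bool (v = u)) = f u"
  using assms by (subst sum.remove[of _ u]; auto intro!: sum.neutral)+

context fin_digraph
begin

text \<open>Testing against the indicator of a vertex recovers the net current there. A self-loop
  occurs in both sums on the left, but its drop is zero.\<close>

lemma net_current_eq:
  fixes R :: "'b \<Rightarrow> real"
  shows "(\<Sum>a \<in> out_arcs G v. (f v - f (head G a)) / R a)
       + (\<Sum>a \<in> in_arcs G v. (f v - f (tail G a)) / R a)
     = dirichlet G R f (\<lambda>w. of_bool (w = v))"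
proof -
  have out: "(\<Sum>a \<in> out_arcs G v. (f v - f (head G a)) / R a)
      = (\<Sum>a\<in>arcs G. vdrop G a f * of_bool (tail G a = v) / R a)"
    by (rule sum.mono_neutral_cong_left) (auto simp: out_arcs_def vdrop_def)
  have inn: "(\<Sum>a \<in> in_arcs G v. (f v - f (tail G a)) / R a)
      = (\<Sum>a\<in>arcs G. - vdrop G a f * of_bool (head G a = v) / R a)"
    by (rule sum.mono_neutral_cong_left) (auto simp: in_arcs_def vdrop_def)
  show ?thesis
    unfolding out inn dirichlet_def sum.distrib[symmetric]
    by (rule sum.cong)
      (simp_all add: vdrop_def[of _ _ "\<lambda>w. of_bool (w = v)"] add_divide_distrib[symmetric]
        algebra_simps)
qed

lemma dirichlet_expand:
  "dirichlet G R f h = (\<Sum>v\<in>verts G. h v * dirichlet G R f (\<lambda>w. of_bool (w = v)))"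
proof -
  have d: "vdrop G a h = (\<Sum>v\<in>verts G. h v * vdrop G a (\<lambda>w. of_bool (w = v)))"
    if "a \<in> arcs G" for a
  proof -
    have "(\<Sum>v\<in>verts G. h v * vdrop G a (\<lambda>w. of_bool (w = v)))
        = (\<Sum>v\<in>verts G. h v * of_bool (tail G a = v)) - (\<Sum>v\<in>verts G. h v * of_bool (head G a = v))"
      by (simp add: vdrop_def right_diff_distrib sum_subtractf)
    with that show ?thesis by (simp add: sum_mult_of_bool_pick vdrop_def)
  qed
  have "dirichlet G R f h
      = (\<Sum>a\<in>arcs G. \<Sum>v\<in>verts G. h v * (vdrop G a f * vdrop G a (\<lambda>w. of_bool (w = v)) / R a))"
    unfolding dirichlet_def
    by (intro sum.cong refl) (simp add: d sum_distrib_left sum_divide_distrib mult_ac)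
  also have "\<dots> = (\<Sum>v\<in>verts G. h v * dirichlet G R f (\<lambda>w. of_bool (w = v)))"
    by (subst sum.swap) (simp add: dirichlet_def sum_distrib_left)
  finally show ?thesis .
qed

lemma unit_current_potential_iff:
  assumes "p \<in> verts G" "q \<in> verts G"
  shows "unit_current_potential G R p q f \<longleftrightarrow> (\<forall>h. dirichlet G R f h = h p - h q)"
proof
  assume "unit_current_potential G R p q f"
  then have *: "dirichlet G R f (\<lambda>w. of_bool (w = v)) = of_bool (v = p) - of_bool (v = q)"
    if "v \<in> verts G" for v
    using that by (auto simp: unit_current_potential_def net_current_eq)
  with assms show "\<forall>h. dirichlet G R f h = h p - h q"
    by (subst dirichlet_expand)
      (simp add: * right_diff_distrib sum_subtractf sum_mult_of_bool_pick)
next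
  assume "\<forall>h. dirichlet G R f h = h p - h q"
  then show "unit_current_potential G R p q f"
    by (auto simp: unit_current_potential_def net_current_eq)
qed

text \<open>Uniqueness comes from the symmetry of the energy: pairing two unit current potentials
  with each other gives the drop of either one.\<close>

lemma eff_resistance_eqI:
  assumes "p \<in> verts G" "q \<in> verts G" and f: "\<And>h. dirichlet G R f h = h p - h q"
  shows "eff_resistance G R p q = f p - f q"
  unfolding eff_resistance_def
proof (rule the_equality)
  show "\<exists>f'. unit_current_potential G R p q f' \<and> f p - f q = f' p - f' q"
    using f assms(1,2) by (auto simp: unit_current_potential_iff)
next
  fix r assume "\<exists>f'. unit_current_potential G R p q f' \<and> r = f' p - f' q"
  then obtain f' where "\<And>h. dirichlet G R f' h = h p - h q" "r = f' p - f' q"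
    using assms(1,2) by (auto simp: unit_current_potential_iff)
  then show "r = f p - f q"
    using f by (metis dirichlet_commute)
qed

end

text \<open>\<open>g x\<close> is the potential of a unit current entering at \<open>x\<close> and leaving at the grounded
  vertex \<open>p\<close>, in weak form.\<close>

definition is_green ::
    "('v, 'e) pre_digraph \<Rightarrow> ('e \<Rightarrow> real) \<Rightarrow> 'v \<Rightarrow> ('v \<Rightarrow> 'v \<Rightarrow> real) \<Rightarrow> bool" where
  "is_green G L p g \<longleftrightarrow>
     (\<forall>x\<in>verts G. g x p = 0 \<and> (\<forall>h. dirichlet G L (g x) h = h x - h p))"

lemma is_greenD:
  assumes "is_green G L p g" "x \<in> verts G"
  shows "g x p = 0" "dirichlet G L (g x) h = h x - h p"
  using assms by (auto simp: is_green_def)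

lemma is_green_sym:
  assumes "is_green G L p g" "x \<in> verts G" "y \<in> verts G"
  shows "g x y = g y x"
  using is_greenD[OF assms(1,2)] is_greenD[OF assms(1,3)] dirichlet_commute[of G L "g x" "g y"]
  by simp

context metrized_graph
begin

text \<open>The energy is a sum of nonnegative terms, so every drop vanishes, and equality
  propagates along walks in the symmetrised graph.\<close>

lemma constant_if_dirichlet_eq_0:
  assumes "dirichlet G L f f = 0" "u \<in> verts G" "v \<in> verts G"
  shows "f u = f v"
proof -
  have nonneg: "vdrop G a f * vdrop G a f / L a \<ge> 0" if "a \<in> arcs G" for a
    using length_pos[OF that] by simp
  have "\<forall>a\<in>arcs G. vdrop G a f * vdrop G a f / L a = 0"
    using assms(1) sum_nonneg_eq_0_iff[OF finite_arcs, of "\<lambda>a. vdrop G a f * vdrop G a f / L a"] nonneg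
    by (auto simp: dirichlet_def)
  then have eq: "f (tail G a) = f (head G a)" if "a \<in> arcs G" for a
    using length_pos[OF that] that by (auto simp: vdrop_def)
  have "u \<rightarrow>\<^sup>*\<^bsub>with_proj (mk_symmetric G)\<^esub> v"
    using connected assms(2,3) by (simp add: connected_def strongly_connected_def)
  then have "(u, v) \<in> rtrancl_on (verts G) (parcs (mk_symmetric G))"
    by (simp add: reachable_def)
  then show ?thesis
    by (induction rule: rtrancl_on_induct) (auto simp: parcs_mk_symmetric eq)
qed

text \<open>The Laplacian with row and column \<open>p\<close> removed is injective: a kernel
  vector, extended by 0 at \<open>p\<close>, has zero energy, so it is constant and equal to its
  value 0 at \<open>p\<close>.\<close>

lemma ex_green:
  assumes p: "p \<in> verts G"
  shows "\<exists>g. is_green G L p g"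
proof -
  define S where "S = verts G - {p}"
  define A where "A v w = dirichlet G L (\<lambda>u. of_bool (u = w)) (\<lambda>u. of_bool (u = v))" for v w
  have ext: "(\<Sum>w\<in>S. A v w * f w) = dirichlet G L f (\<lambda>u. of_bool (u = v))"
    if "f p = 0" for f v
  proof -
    have "(\<Sum>w\<in>S. A v w * f w) = (\<Sum>w\<in>verts G. f w * A v w)"
      using that p by (intro sum.mono_neutral_cong_left) (auto simp: S_def mult.commute)
    then show ?thesis
      by (subst dirichlet_commute, subst dirichlet_expand) (simp add: A_def dirichlet_commute)
  qed
  have "\<exists>f. f p = 0 \<and> (\<forall>h. dirichlet G L f h = h x - h p)" if x: "x \<in> verts G" for x
  proof -
    have "\<exists>f. \<forall>v\<in>S. (\<Sum>w\<in>S. A v w * f w) = of_bool (v = x)"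
    proof (rule injective_square_system_solvable)
      show "finite S" by (simp add: S_def)
    next
      fix f assume f: "\<And>v. v \<in> S \<Longrightarrow> (\<Sum>w\<in>S. A v w * f w) = 0"
      define f' where "f' = f(p := 0)"
      have "(\<Sum>w\<in>S. A v w * f w) = (\<Sum>w\<in>S. A v w * f' w)" for v
        by (rule sum.cong) (auto simp: f'_def S_def)
      then have "dirichlet G L f' (\<lambda>u. of_bool (u = v)) = 0" if "v \<in> S" for v
        using ext[of f' v] f[OF that] by (simp add: f'_def)
      then have "dirichlet G L f' f' = 0"
        by (subst dirichlet_expand) (auto simp: S_def f'_def intro!: sum.neutral)
      then have "f' v = f' p" if "v \<in> verts G" for v
        using constant_if_dirichlet_eq_0 that p by blast
      then show "\<forall>v\<in>S. f v = 0" by (metis DiffE S_def f'_def fun_upd_apply insertCI)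
    qed
    then obtain f where f: "\<And>v. v \<in> S \<Longrightarrow> (\<Sum>w\<in>S. A v w * f w) = of_bool (v = x)" by blast
    \<comment> \<open>The grounding condition: the system only determines values on
      \<open>S\<close>, and the value at \<open>p\<close> is set to 0.\<close>
    define f' where "f' = f(p := 0)"
    have "(\<Sum>w\<in>S. A v w * f w) = (\<Sum>w\<in>S. A v w * f' w)" for v
      by (rule sum.cong) (auto simp: f'_def S_def)
    then have f': "dirichlet G L f' (\<lambda>u. of_bool (u = v)) = of_bool (v = x)" if "v \<in> S" for v
      using ext[of f' v] f[OF that] by (simp add: f'_def)
    have "dirichlet G L f' h = h x - h p" for h
    proof -
      \<comment> \<open>Subtracting the constant \<open>h p\<close> makes the test function vanish
        at \<open>p\<close>, the one vertex where no equation was imposed.\<close>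
      have "dirichlet G L f' h = dirichlet G L f' (\<lambda>v. h v - h p)"
        by (simp add: dirichlet_def vdrop_diff vdrop_const)
      also have "\<dots> = (\<Sum>v\<in>verts G. (h v - h p) * of_bool (v = x))"
      proof (subst dirichlet_expand, rule sum.cong)
        fix v assume "v \<in> verts G"
        with f'[of v] show "(h v - h p) * dirichlet G L f' (\<lambda>u. of_bool (u = v))
            = (h v - h p) * of_bool (v = x)"
          by (cases "v = p") (auto simp: S_def)
      qed simp
      also have "\<dots> = h x - h p"
        using x by (simp add: sum_mult_of_bool_pick)
      finally show ?thesis .
    qed
    then show ?thesis by (intro exI[of _ f']) (simp add: f'_def)
  qed
  then show ?thesis
    unfolding is_green_def by (intro bchoice ballI)
qed

end

section \<open>Extending the Green function from vertices to all points\<close>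

section \<open>The resistance function\<close>

definition gaps :: "real set \<Rightarrow> (real \<times> real) set" where
  "gaps C = {(s, t). s \<in> C \<and> t \<in> C \<and> s < t \<and> (\<forall>u\<in>C. \<not> (s < u \<and> u < t))}"

lemma finite_gaps: "finite C \<Longrightarrow> finite (gaps C)"
  by (rule finite_subset[of _ "C \<times> C"]) (auto simp: gaps_def)

text \<open>Induction by adding a new maximum \<open>b\<close>, which creates exactly one new gap,
  from the old maximum to \<open>b\<close>.\<close>

lemma sum_gaps_telescope:
  fixes h :: "real \<Rightarrow> real"
  assumes "finite C" "C \<noteq> {}"
  shows "(\<Sum>(s, t)\<in>gaps C. h t - h s) = h (Max C) - h (Min C)"
  using assms
proof (induction rule: finite_linorder_max_induct)
  case empty
  then show ?case by simp
next
  case (insert b A)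
  show ?case
  proof (cases "A = {}")
    case True
    have "gaps {b} = {}" by (auto simp: gaps_def)
    with True show ?thesis by simp
  next
    case False
    have lt: "a < b" "a \<le> Max A" if "a \<in> A" for a
      using insert.hyps that by auto
    have Max_A: "Max A \<in> A" "Max A < b" using False insert.hyps by auto
    have "gaps (insert b A) = insert (Max A, b) (gaps A)"
    proof (intro set_eqI; clarify)
      fix s t
      show "(s, t) \<in> gaps (insert b A) \<longleftrightarrow> (s, t) \<in> insert (Max A, b) (gaps A)"
      proof (cases "t = b")
        case True
        have "(s, t) \<notin> gaps A" using True lt(1)[of t] by (auto simp: gaps_def)
        moreover have "(s, t) \<in> gaps (insert b A) \<longleftrightarrow> s = Max A"
        proof
          assume "(s, t) \<in> gaps (insert b A)"
          with True Max_A have "s \<in> A" "Max A \<le> s" by (auto simp: gaps_def not_less)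
          with lt(2) show "s = Max A" by (auto intro: antisym)
        next
          assume "s = Max A"
          with True Max_A lt(2) show "(s, t) \<in> gaps (insert b A)" by (auto simp: gaps_def not_less)
        qed
        ultimately show ?thesis using True by simp
      next
        case False
        with lt show ?thesis unfolding gaps_def by fastforce
      qed
    qed
    moreover have "(Max A, b) \<notin> gaps A" using lt(1)[of b] by (auto simp: gaps_def)
    moreover have "Max (insert b A) = b" "Min (insert b A) = Min A"
      using False insert.hyps lt Max_A
      by (auto intro!: Max_eqI Min_eqI simp: less_imp_le)
    ultimately show ?thesis
      using insert.IH[OF False] finite_gaps[OF insert.hyps(1)] by simp
  qed
qed

text \<open>For a cut point \<open>u\<close>, the function \<open>\<lambda>s. min s u\<close> has slope 1 or 0 on each gap, so
  that both parts of the sum telescope.\<close>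

lemma sum_gaps_hinge:
  fixes f h :: "real \<Rightarrow> real"
  assumes C: "finite C" "C \<subseteq> {0..l}" "0 \<in> C" "l \<in> C" "u \<in> C"
    and f: "\<And>s. s \<in> {0..l} \<Longrightarrow> f s = \<alpha> + \<beta> * s + \<kappa> * min s u"
  shows "(\<Sum>(s, t)\<in>gaps C. (f s - f t) * (h s - h t) / (t - s))
       = \<beta> * (h l - h 0) + \<kappa> * (h u - h 0)"
proof -
  have MM: "Max C = l" "Min C = 0"
    using C by (auto intro!: Max_eqI Min_eqI)
  have "(\<Sum>(s, t)\<in>gaps C. (f s - f t) * (h s - h t) / (t - s))
      = (\<Sum>(s, t)\<in>gaps C. \<beta> * (h t - h s) + \<kappa> * (h (min t u) - h (min s u)))"
  proof (rule sum.cong, simp, clarify)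
    fix s t assume st: "(s, t) \<in> gaps C"
    then have "s \<in> {0..l}" "t \<in> {0..l}" and less: "s < t" using C by (auto simp: gaps_def)
    then have ff: "f s - f t = \<beta> * (s - t) + \<kappa> * (min s u - min t u)"
      by (simp add: f algebra_simps)
    have "t \<le> u \<or> u \<le> s" using st C(5) by (auto simp: gaps_def not_less)
    with less show "(f s - f t) * (h s - h t) / (t - s)
        = \<beta> * (h t - h s) + \<kappa> * (h (min t u) - h (min s u))"
      unfolding ff by (auto simp: min_def field_simps)
  qed
  also have "\<dots> = \<beta> * (\<Sum>(s, t)\<in>gaps C. h t - h s)
      + \<kappa> * (\<Sum>(s, t)\<in>gaps C. (h \<circ> (\<lambda>s. min s u)) t - (h \<circ> (\<lambda>s. min s u)) s)"
    by (simp add: sum.distrib sum_distrib_left case_prod_unfold)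
  also have "\<dots> = \<beta> * (h l - h 0) + \<kappa> * (h u - h 0)"
  proof -
    have "C \<noteq> {}" "u \<in> {0..l}" using C by auto
    then show ?thesis
      unfolding sum_gaps_telescope[OF C(1) \<open>C \<noteq> {}\<close>] MM by (simp add: min_absorb1 min_absorb2)
  qed
  finally show ?thesis .
qed

primrec interp ::
    "('v, 'e) pre_digraph \<Rightarrow> ('e \<Rightarrow> real) \<Rightarrow> ('v \<Rightarrow> real) \<Rightarrow> ('v, 'e) point \<Rightarrow> real" where
  "interp G L \<phi> (Vertex v) = \<phi> v"
| "interp G L \<phi> (Inner a t) = (1 - t / L a) * \<phi> (tail G a) + t / L a * \<phi> (head G a)"

text \<open>The Green function of a single edge grounded at both ends.\<close>

fun bump :: "('e \<Rightarrow> real) \<Rightarrow> ('v, 'e) point \<Rightarrow> ('v, 'e) point \<Rightarrow> real" where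
  "bump L (Inner a s) (Inner b t) = (if a = b then min s t - s * t / L a else 0)"
| "bump L _ _ = 0"

text \<open>The Green function on all points, grounded at the same vertex: the bilinear
  interpolation of \<open>g\<close> carries the current between the ends of the edges, and
  \<open>bump\<close> adds the kink at the source. It is defined without reference to any
  refinement.\<close>

definition green_pt ::
    "('v, 'e) pre_digraph \<Rightarrow> ('e \<Rightarrow> real) \<Rightarrow> ('v \<Rightarrow> 'v \<Rightarrow> real)
      \<Rightarrow> ('v, 'e) point \<Rightarrow> ('v, 'e) point \<Rightarrow> real" where
  "green_pt G L g x y = interp G L (\<lambda>v. interp G L (\<lambda>w. g w v) x) y + bump L x y"

context metrized_graph
begin

abbreviation "len \<equiv> (\<lambda>(a :: 'e, s :: real, t). t - s)"

lemma Vertex_in_points [simp]: "Vertex v \<in> points G L \<longleftrightarrow> v \<in> verts G"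
  by (auto simp: points_def)

lemma Inner_in_points [simp]: "Inner a t \<in> points G L \<longleftrightarrow> a \<in> arcs G \<and> 0 < t \<and> t < L a"
  by (auto simp: points_def)

lemma interp_edge_point:
  assumes "a \<in> arcs G" "0 \<le> s" "s \<le> L a"
  shows "interp G L \<phi> (edge_point G L a s) = \<phi> (tail G a) + s / L a * (\<phi> (head G a) - \<phi> (tail G a))"
  using assms length_pos[OF assms(1)] by (auto simp: edge_point_def algebra_simps)

lemma bump_edge_point:
  assumes "a \<in> arcs G" "x \<in> points G L" "0 \<le> s" "s \<le> L a"
  shows "bump L x (edge_point G L a s)
       = (case x of Vertex v \<Rightarrow> 0 | Inner b u \<Rightarrow> if a = b then min s u - s * u / L a else 0)"
  using assms length_pos[OF assms(1)]
  by (auto simp: edge_point_def min_def mult.commute split: point.split)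

lemma cuts_bounds:
  assumes "a \<in> arcs G" "P \<subseteq> points G L" "finite P"
  shows "finite (cuts L P a)" "cuts L P a \<subseteq> {0..L a}" "0 \<in> cuts L P a" "L a \<in> cuts L P a"
proof -
  have "{t. Inner a t \<in> P} = Inner a -` P" by auto
  then show "finite (cuts L P a)"
    using finite_vimageI[OF assms(3), of "Inner a"] by (simp add: cuts_def inj_def)
  show "cuts L P a \<subseteq> {0..L a}" "0 \<in> cuts L P a" "L a \<in> cuts L P a"
    using assms(1,2) length_pos[OF assms(1)] by (auto simp: cuts_def)
qed

lemma arcs_refine: "arcs (refine G L P) = Sigma (arcs G) (\<lambda>a. gaps (cuts L P a))"
  by (auto simp: refine_def gaps_def)

lemma fin_digraph_refine:
  assumes P: "P \<subseteq> points G L" "finite P"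
  shows "fin_digraph (refine G L P)"
proof
  have ep: "edge_point G L a s \<in> Vertex ` verts G \<union> P"
    if "a \<in> arcs G" "s \<in> cuts L P a" for a s
    using that by (auto simp: edge_point_def cuts_def)
  show "finite (verts (refine G L P))"
    using P(2) by (simp add: refine_def)
  show "finite (arcs (refine G L P))"
    unfolding arcs_refine using cuts_bounds[OF _ P] by (intro finite_SigmaI finite_gaps) auto
  fix e assume "e \<in> arcs (refine G L P)"
  then show "tail (refine G L P) e \<in> verts (refine G L P)"
    "head (refine G L P) e \<in> verts (refine G L P)"
    using ep by (auto simp: refine_def)
qed

lemma dirichlet_refine:
  assumes P: "P \<subseteq> points G L" "finite P"
  shows "dirichlet (refine G L P) len f h
       = (\<Sum>a\<in>arcs G. \<Sum>(s, t)\<in>gaps (cuts L P a).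
            (f (edge_point G L a s) - f (edge_point G L a t))
              * (h (edge_point G L a s) - h (edge_point G L a t)) / (t - s))"
  unfolding dirichlet_def arcs_refine
  by (subst sum.Sigma)
    (auto simp: cuts_bounds[OF _ P] finite_gaps vdrop_def refine_def intro!: sum.cong)

lemma edge_point_ends:
  assumes "a \<in> arcs G"
  shows "edge_point G L a 0 = Vertex (tail G a)" "edge_point G L a (L a) = Vertex (head G a)"
  using length_pos[OF assms] by (auto simp: edge_point_def)

text \<open>Unit current entering at an interior point is split between the two ends of its edge
  with the interpolation weights.\<close>

lemma dirichlet_interp:
  assumes "is_green G L p g" "x \<in> points G L"
  shows "dirichlet G L (\<lambda>v. interp G L (\<lambda>w. g w v) x) h = interp G L h x - h p"
proof (cases x)
  case (Vertex v)
  with assms show ?thesis by (simp add: is_greenD)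
next
  case (Inner a t)
  have "dirichlet G L (\<lambda>v. interp G L (\<lambda>w. g w v) x) h
      = (1 - t / L a) * dirichlet G L (g (tail G a)) h + t / L a * dirichlet G L (g (head G a)) h"
    unfolding Inner interp.simps dirichlet_add dirichlet_cmult ..
  with assms Inner show ?thesis by (simp add: is_greenD) (simp add: algebra_simps diff_divide_distrib)
qed

text \<open>Along each edge \<open>green_pt\<close> is affine plus a possible hinge at
  \<open>x\<close>, so \<open>sum_gaps_hinge\<close> collapses the energy of the subdivided edge to
  that of the whole edge, up to a correction on the edge containing \<open>x\<close>.\<close>

lemma dirichlet_green_pt:
  assumes P: "P \<subseteq> points G L" "finite P" and g: "is_green G L p g" and x: "x \<in> P"
  shows "dirichlet (refine G L P) len (green_pt G L g x) h = h x - h (Vertex p)"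
proof -
  have x': "x \<in> points G L" using P x by auto
  define \<Phi> where "\<Phi> v = interp G L (\<lambda>w. g w v) x" for v
  define H where "H v = h (Vertex v)" for v
  \<comment> \<open>The correction replaces the interpolated value of \<open>h\<close> at
    \<open>x\<close>, which the vertex network delivers, by the true value.\<close>
  define D where "D a = (case x of Vertex v \<Rightarrow> 0
      | Inner b u \<Rightarrow> if a = b then h x - interp G L H x else 0)" for a
  have edge: "(\<Sum>(s, t)\<in>gaps (cuts L P a).
            (green_pt G L g x (edge_point G L a s) - green_pt G L g x (edge_point G L a t))
              * (h (edge_point G L a s) - h (edge_point G L a t)) / (t - s))
       = vdrop G a \<Phi> * vdrop G a H / L a + D a" if a: "a \<in> arcs G" for a
  proof (cases "\<exists>u. x = Inner a u")
    case True
    then obtain u where u: "x = Inner a u" by blast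
    \<comment> \<open>The bump at \<open>u\<close> contributes the slope \<open>- u / L a\<close>
      and a hinge of coefficient 1.\<close>
    have "green_pt G L g x (edge_point G L a s)
        = \<Phi> (tail G a) + ((\<Phi> (head G a) - \<Phi> (tail G a)) / L a - u / L a) * s + 1 * min s u"
      if "s \<in> {0..L a}" for s
      using that a u x' unfolding green_pt_def \<Phi>_def[symmetric]
      by (simp add: interp_edge_point bump_edge_point) (simp add: algebra_simps diff_divide_distrib)
    from sum_gaps_hinge[OF cuts_bounds[OF a P] _ this, of "\<lambda>s. h (edge_point G L a s)"] x u
    have "(\<Sum>(s, t)\<in>gaps (cuts L P a).
            (green_pt G L g x (edge_point G L a s) - green_pt G L g x (edge_point G L a t))
              * (h (edge_point G L a s) - h (edge_point G L a t)) / (t - s))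
        = ((\<Phi> (head G a) - \<Phi> (tail G a)) / L a - u / L a)
            * (h (edge_point G L a (L a)) - h (edge_point G L a 0))
          + 1 * (h (edge_point G L a u) - h (edge_point G L a 0))"
      by (simp add: cuts_def)
    moreover have "edge_point G L a u = x" using u x' by (auto simp: edge_point_def)
    ultimately show ?thesis
      using length_pos[OF a] u
      by (simp add: edge_point_ends[OF a] D_def vdrop_def H_def field_simps)
  next
    case False
    then have D: "D a = 0" by (auto simp: D_def split: point.split)
    have "green_pt G L g x (edge_point G L a s)
        = \<Phi> (tail G a) + ((\<Phi> (head G a) - \<Phi> (tail G a)) / L a) * s + 0 * min s 0"
      if "s \<in> {0..L a}" for s
      using that a False x' unfolding green_pt_def \<Phi>_def[symmetric]
      by (simp add: interp_edge_point bump_edge_point split: point.split)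
    from sum_gaps_hinge[OF cuts_bounds[OF a P] cuts_bounds(3)[OF a P] this,
        of "\<lambda>s. h (edge_point G L a s)"] show ?thesis
      using length_pos[OF a] by (simp add: edge_point_ends[OF a] D vdrop_def H_def field_simps)
  qed
  have "(\<Sum>a\<in>arcs G. D a) = h x - interp G L H x"
  proof (cases x)
    case (Vertex v)
    then show ?thesis by (simp add: D_def H_def)
  next
    case (Inner b u)
    then have "b \<in> arcs G" using x' by simp
    then show ?thesis by (simp add: D_def Inner)
  qed
  moreover have "(\<Sum>a\<in>arcs G. vdrop G a \<Phi> * vdrop G a H / L a) = interp G L H x - H p"
    using dirichlet_interp[OF g x', of H] by (simp add: dirichlet_def \<Phi>_def[abs_def])
  ultimately show ?thesis
    using edge by (simp add: dirichlet_refine[OF P] sum.distrib H_def)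
qed

lemma green_pt_sym:
  assumes g: "is_green G L p g" and "x \<in> points G L" "y \<in> points G L"
  shows "green_pt G L g x y = green_pt G L g y x"
proof -
  note sym = is_green_sym[OF g]
  show ?thesis
  proof (cases x; cases y)
    fix v w assume "x = Vertex v" "y = Vertex w"
    with assms show ?thesis by (simp add: green_pt_def sym)
  next
    fix v b t assume "x = Vertex v" "y = Inner b t"
    with assms show ?thesis by (simp add: green_pt_def sym[of v])
  next
    fix v a s assume "x = Inner a s" "y = Vertex v"
    with assms show ?thesis by (simp add: green_pt_def sym[of v])
  next
    fix a b s t assume xy: "x = Inner a s" "y = Inner b t"
    with assms have "a \<in> arcs G" "b \<in> arcs G" by auto
    then show ?thesis
      unfolding xy
      by (cases "a = b")
        (simp_all add: green_pt_def sym min.commute,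
         simp_all add: algebra_simps diff_divide_distrib add_divide_distrib)
  qed
qed

text \<open>The difference of the Green functions of \<open>x\<close> and \<open>y\<close> is a unit
  current potential on the refinement at these two points; the grounding terms cancel.\<close>

lemma resistance_eq:
  assumes g: "is_green G L p g" and xy: "x \<in> points G L" "y \<in> points G L"
  shows "resistance G L x y = green_pt G L g x x + green_pt G L g y y - 2 * green_pt G L g x y"
proof -
  have P: "{x, y} \<subseteq> points G L" "finite {x, y}" using xy by auto
  interpret refined: fin_digraph "refine G L {x, y}" by (rule fin_digraph_refine[OF P])
  define f where "f z = green_pt G L g x z - green_pt G L g y z" for z
  have "resistance G L x y = f x - f y"
    unfolding resistance_def
  proof (rule refined.eff_resistance_eqI)
    show "x \<in> verts (refine G L {x, y})" "y \<in> verts (refine G L {x, y})"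
      by (auto simp: refine_def)
    show "dirichlet (refine G L {x, y}) len f h = h x - h y" for h
      unfolding f_def dirichlet_diff by (simp add: dirichlet_green_pt[OF P g])
  qed
  then show ?thesis by (simp add: f_def green_pt_sym[OF g xy])
qed

end

section \<open>Integrating the squared derivative and eliminating the base point\<close>

section \<open>The tau constant\<close>

lemma integral_deriv_squared_hinge:
  fixes \<phi> :: "real \<Rightarrow> real"
  assumes "0 \<le> l" "0 \<le> u" "u \<le> l"
    and \<phi>: "\<And>s. 0 < s \<Longrightarrow> s < l \<Longrightarrow> \<phi> s = A * s\<^sup>2 + B * s + C + \<kappa> * min s u"
  shows "integral {0..l} (\<lambda>t. (deriv \<phi> t)\<^sup>2)
       = 4 * A\<^sup>2 * l^3 / 3 + 2 * A * B * l\<^sup>2 + B\<^sup>2 * l + 2 * \<kappa> * (A * u\<^sup>2 + B * u) + \<kappa>\<^sup>2 * u"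
proof -
  \<comment> \<open>An antiderivative on either side of \<open>u\<close>: left of \<open>u\<close>
    the \<open>min\<close> terms supply the extra slope \<open>\<kappa>\<close>, right of
    \<open>u\<close> they are constant. It is continuous at \<open>u\<close>, so the fundamental
    theorem applies with that point excepted.\<close>
  define F where "F s = 4 * A\<^sup>2 * s^3 / 3 + 2 * A * B * s\<^sup>2 + B\<^sup>2 * s
      + 2 * \<kappa> * (A * (min s u)\<^sup>2 + B * min s u) + \<kappa>\<^sup>2 * min s u" for s
  have "((\<lambda>t. (deriv \<phi> t)\<^sup>2) has_integral (F l - F 0)) {0..l}"
  proof (rule fundamental_theorem_of_calculus_interior_strong[where S = "{u}"])
    fix t assume "t \<in> {0<..<l} - {u}"
    then have t: "0 < t" "t < l" "t \<noteq> u" by auto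
    show "(F has_vector_derivative (deriv \<phi> t)\<^sup>2) (at t)"
    proof (cases "t < u")
      case True
      have "((\<lambda>s. A * s\<^sup>2 + B * s + C + \<kappa> * s) has_real_derivative 2 * A * t + B + \<kappa>) (at t)"
        by (auto intro!: derivative_eq_intros)
      then have "(\<phi> has_real_derivative 2 * A * t + B + \<kappa>) (at t)"
        by (rule has_field_derivative_transform_within_open[of _ _ _ "{0<..<u}"])
          (use t True assms(3) \<phi> in auto)
      then have d: "deriv \<phi> t = 2 * A * t + B + \<kappa>" by (rule DERIV_imp_deriv)
      have "((\<lambda>s. 4 * A\<^sup>2 * s^3 / 3 + 2 * A * B * s\<^sup>2 + B\<^sup>2 * s
          + 2 * \<kappa> * (A * s\<^sup>2 + B * s) + \<kappa>\<^sup>2 * s) has_real_derivative (2 * A * t + B + \<kappa>)\<^sup>2) (at t)"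
        by (auto intro!: derivative_eq_intros simp: power2_eq_square algebra_simps)
      then have "(F has_real_derivative (2 * A * t + B + \<kappa>)\<^sup>2) (at t)"
        by (rule has_field_derivative_transform_within_open[of _ _ _ "{0<..<u}"])
          (use t True in \<open>auto simp: F_def\<close>)
      then show ?thesis by (simp add: d has_real_derivative_iff_has_vector_derivative)
    next
      case False
      have "((\<lambda>s. A * s\<^sup>2 + B * s + C + \<kappa> * u) has_real_derivative 2 * A * t + B) (at t)"
        by (auto intro!: derivative_eq_intros)
      then have "(\<phi> has_real_derivative 2 * A * t + B) (at t)"
        by (rule has_field_derivative_transform_within_open[of _ _ _ "{u<..<l}"])
          (use t False assms(2) \<phi> in auto)
      then have d: "deriv \<phi> t = 2 * A * t + B" by (rule DERIV_imp_deriv)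
      have "((\<lambda>s. 4 * A\<^sup>2 * s^3 / 3 + 2 * A * B * s\<^sup>2 + B\<^sup>2 * s
          + 2 * \<kappa> * (A * u\<^sup>2 + B * u) + \<kappa>\<^sup>2 * u) has_real_derivative (2 * A * t + B)\<^sup>2) (at t)"
        by (auto intro!: derivative_eq_intros simp: power2_eq_square algebra_simps)
      then have "(F has_real_derivative (2 * A * t + B)\<^sup>2) (at t)"
        by (rule has_field_derivative_transform_within_open[of _ _ _ "{u<..<l}"])
          (use t False in \<open>auto simp: F_def\<close>)
      then show ?thesis by (simp add: d has_real_derivative_iff_has_vector_derivative)
    qed
  next
    show "continuous_on {0..l} F"
      unfolding F_def by (intro continuous_intros) auto
  qed (use assms in auto)
  then show ?thesis
    using assms(1-3) by (simp add: integral_unique F_def)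
qed

definition dipole :: "('v, 'e) pre_digraph \<Rightarrow> ('v \<Rightarrow> 'v \<Rightarrow> real) \<Rightarrow> 'e \<Rightarrow> 'v \<Rightarrow> real" where
  "dipole G g a v = g (tail G a) v - g (head G a) v"

text \<open>Divided by \<open>L b\<close>, this is the current through \<open>b\<close> driven by a
  unit dipole at the ends of \<open>a\<close>. When \<open>g\<close> is a Green function, the
  diagonal entry is the effective resistance in \<open>G\<close> between the ends of
  \<open>a\<close>.\<close>

definition transfer :: "('v, 'e) pre_digraph \<Rightarrow> ('v \<Rightarrow> 'v \<Rightarrow> real) \<Rightarrow> 'e \<Rightarrow> 'e \<Rightarrow> real" where
  "transfer G g a b = vdrop G b (dipole G g a)"

text \<open>The integral over an edge with the base point at distance \<open>u\<close> from its
  tail. The letters \<open>tt\<close>, \<open>th\<close>, \<open>hh\<close> stand for the Green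
  function at pairs of ends, \<open>Yt\<close> and \<open>Yh\<close> for the potential of the base
  point at the ends. The right side isolates the terms that depend on the base point.\<close>

lemma hinge_energy_identity:
  fixes l u tt th hh :: real
  assumes "l > 0"
  defines "Yt \<equiv> (1 - u / l) * tt + u / l * th" and "Yh \<equiv> (1 - u / l) * th + u / l * hh"
    and "A \<equiv> (tt - 2 * th + hh) / l\<^sup>2 - 1 / l"
  defines "B \<equiv> 2 * (th - tt) / l + 1 - 2 * ((Yh - Yt) / l - u / l)"
  shows "4 * A\<^sup>2 * l^3 / 3 + 2 * A * B * l\<^sup>2 + B\<^sup>2 * l + 2 * (-2) * (A * u\<^sup>2 + B * u) + (-2)\<^sup>2 * u
       = (l - (tt - 2 * th + hh))\<^sup>2 / (3 * l) + (tt - hh)\<^sup>2 / l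
         - 4 * ((Yt - Yh) * ((tt - Yt) - (hh - Yh)) / l)
         + 4 * ((1 - u / l) * (tt - Yt) + u / l * (hh - Yh))"
proof -
  \<comment> \<open>The ratio \<open>m\<close> clears \<open>u / l\<close>, so that after removing
    denominators the claim is polynomial.\<close>
  define m where "m = u / l"
  have u: "u = m * l" using assms(1) by (simp add: m_def)
  have A: "A = (tt - 2 * th + hh - l) / l\<^sup>2"
    using assms(1) by (simp add: A_def field_simps power2_eq_square)
  have B: "B = (2 * (th - tt) + l - 2 * (Yh - Yt - u)) / l"
    using assms(1) by (simp add: B_def field_simps)
  show ?thesis
    unfolding A B unfolding Yt_def Yh_def m_def[symmetric] unfolding u
    using assms(1) by (simp add: divide_simps power2_eq_square power3_eq_cube) algebra
qed

lemma linear_energy_identity: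
  fixes l tt th hh Yt Yh :: real
  assumes "l > 0"
  defines "A \<equiv> (tt - 2 * th + hh) / l\<^sup>2 - 1 / l"
  defines "B \<equiv> 2 * (th - tt) / l + 1 - 2 * ((Yh - Yt) / l)"
  shows "4 * A\<^sup>2 * l^3 / 3 + 2 * A * B * l\<^sup>2 + B\<^sup>2 * l
       = (l - (tt - 2 * th + hh))\<^sup>2 / (3 * l) + (tt - hh)\<^sup>2 / l
         - 4 * ((Yt - Yh) * ((tt - Yt) - (hh - Yh)) / l)"
proof -
  have A: "A = (tt - 2 * th + hh - l) / l\<^sup>2"
    using assms(1) by (simp add: A_def field_simps power2_eq_square)
  have B: "B = (2 * (th - tt) + l - 2 * (Yh - Yt)) / l"
    using assms(1) by (simp add: B_def field_simps)
  show ?thesis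
    unfolding A B
    using assms(1) by (simp add: divide_simps power2_eq_square power3_eq_cube) algebra
qed

context metrized_graph
begin

lemma transfer_self:
  assumes "is_green G L p g" "a \<in> arcs G"
  shows "transfer G g a a
       = g (tail G a) (tail G a) - 2 * g (tail G a) (head G a) + g (head G a) (head G a)"
  using is_green_sym[OF assms(1), of "tail G a" "head G a"] assms(2)
  by (simp add: transfer_def dipole_def vdrop_def)

text \<open>By \<open>resistance_eq\<close> the resistance is quadratic along the edge. If
  \<open>y\<close> is interior to this edge, the term \<open>- 2 * green_pt\<close> adds a hinge of
  coefficient -2. The last two terms are arranged to cancel after summation over all edges.\<close>

lemma edge_integral:
  assumes g: "is_green G L p g" and y: "y \<in> points G L" and a: "a \<in> arcs G"
  defines "Y \<equiv> \<lambda>v. interp G L (\<lambda>w. g w v) y" and "K \<equiv> \<lambda>v. g v v"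
  shows "integral {0..L a} (\<lambda>t. (deriv (\<lambda>s. resistance G L (edge_point G L a s) y) t)\<^sup>2)
       = (L a - transfer G g a a)\<^sup>2 / (3 * L a) + (vdrop G a K)\<^sup>2 / L a
         - 4 * (vdrop G a Y * vdrop G a (\<lambda>v. K v - Y v) / L a)
         + 4 * (case y of Vertex v \<Rightarrow> 0 | Inner b u \<Rightarrow>
             if a = b then interp G L (\<lambda>v. K v - Y v) y else 0)"
proof -
  define l where "l = L a"
  define tt th hh where "tt = g (tail G a) (tail G a)" and "th = g (tail G a) (head G a)"
    and "hh = g (head G a) (head G a)"
  have l: "l > 0" using length_pos[OF a] by (simp add: l_def)
  have ht: "g (head G a) (tail G a) = th" using is_green_sym[OF g] a by (simp add: th_def)
  define A where "A = (tt - 2 * th + hh) / l\<^sup>2 - 1 / l"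
  define Yt Yh where "Yt = Y (tail G a)" and "Yh = Y (head G a)"
  have T: "transfer G g a a = tt - 2 * th + hh"
    by (simp add: transfer_self[OF g a] tt_def th_def hh_def)
  define b where "b s = bump L y (Inner a s)" for s
  have res: "resistance G L (edge_point G L a s) y
      = A * s\<^sup>2 + (2 * (th - tt) / l + 1 - 2 * ((Yh - Yt) / l)) * s
        + (tt + green_pt G L g y y - 2 * Yt) - 2 * b s"
    if s: "0 < s" "s < L a" for s
  proof -
    have pt: "edge_point G L a s = Inner a s" using s by (simp add: edge_point_def)
    have x: "Inner a s \<in> points G L" using s a by simp
    have 1: "green_pt G L g y (Inner a s) = Yt + (Yh - Yt) / l * s + b s"
      by (simp add: green_pt_def b_def Yt_def Yh_def Y_def l_def algebra_simps diff_divide_distrib)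
    \<comment> \<open>On the diagonal the bump is s - s^2 / l; this is the source of the summand
      \<open>- 1 / l\<close> in \<open>A\<close>.\<close>
    have 2: "green_pt G L g (Inner a s) (Inner a s)
        = tt + 2 * (th - tt) / l * s + (tt - 2 * th + hh) / l\<^sup>2 * s\<^sup>2 + s - s\<^sup>2 / l"
      using l by (simp add: green_pt_def ht tt_def[symmetric] th_def[symmetric] hh_def[symmetric]
          l_def[symmetric]) (simp add: field_simps power2_eq_square)
    show ?thesis
      unfolding pt resistance_eq[OF g x y] green_pt_sym[OF g x y] 1 2
      by (simp add: A_def algebra_simps)
  qed
  show ?thesis
  proof (cases "\<exists>u. y = Inner a u")
    case True
    then obtain u where u: "y = Inner a u" by blast
    with y have u': "0 < u" "u < l" by (auto simp: l_def)
    have b: "b s = min s u - u / l * s" for s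
      by (simp add: b_def u l_def min.commute)
    have Y: "Yt = (1 - u / l) * tt + u / l * th" "Yh = (1 - u / l) * th + u / l * hh"
      by (simp_all add: Yt_def Yh_def Y_def u ht tt_def th_def hh_def l_def[symmetric])
    have "integral {0..l} (\<lambda>t. (deriv (\<lambda>s. resistance G L (edge_point G L a s) y) t)\<^sup>2)
        = 4 * A\<^sup>2 * l^3 / 3 + 2 * A * (2 * (th - tt) / l + 1 - 2 * ((Yh - Yt) / l - u / l)) * l\<^sup>2
          + (2 * (th - tt) / l + 1 - 2 * ((Yh - Yt) / l - u / l))\<^sup>2 * l
          + 2 * (-2) * (A * u\<^sup>2 + (2 * (th - tt) / l + 1 - 2 * ((Yh - Yt) / l - u / l)) * u)
          + (-2)\<^sup>2 * u"
    proof (rule integral_deriv_squared_hinge)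
      fix s assume "0 < s" "s < l"
      then show "resistance G L (edge_point G L a s) y
          = A * s\<^sup>2 + (2 * (th - tt) / l + 1 - 2 * ((Yh - Yt) / l - u / l)) * s
            + (tt + green_pt G L g y y - 2 * Yt) + (-2) * min s u"
        by (simp add: res[folded l_def] b algebra_simps)
    qed (use u' in auto)
    also note hinge_energy_identity[OF l, of tt th hh u, folded Y, folded A_def]
    finally show ?thesis
      by (simp add: u T l_def[symmetric] vdrop_def K_def Yt_def[symmetric] Yh_def[symmetric]
          tt_def[symmetric] hh_def[symmetric])
  next
    case False
    then have b: "b s = 0" for s
      by (cases y) (auto simp: b_def)
    \<comment> \<open>With \<open>y\<close> off the interior of this edge there is no kink: the
      hinge is taken at 0 with coefficient 0.\<close>
    have "integral {0..l} (\<lambda>t. (deriv (\<lambda>s. resistance G L (edge_point G L a s) y) t)\<^sup>2)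
        = 4 * A\<^sup>2 * l^3 / 3 + 2 * A * (2 * (th - tt) / l + 1 - 2 * ((Yh - Yt) / l)) * l\<^sup>2
          + (2 * (th - tt) / l + 1 - 2 * ((Yh - Yt) / l))\<^sup>2 * l
          + 2 * 0 * (A * 0\<^sup>2 + (2 * (th - tt) / l + 1 - 2 * ((Yh - Yt) / l)) * 0) + 0\<^sup>2 * 0"
    proof (rule integral_deriv_squared_hinge)
      fix s assume "0 < s" "s < l"
      then show "resistance G L (edge_point G L a s) y
          = A * s\<^sup>2 + (2 * (th - tt) / l + 1 - 2 * ((Yh - Yt) / l)) * s
            + (tt + green_pt G L g y y - 2 * Yt) + 0 * min s 0"
        by (simp add: res[folded l_def] b)
    qed (use l in auto)
    then have "integral {0..l} (\<lambda>t. (deriv (\<lambda>s. resistance G L (edge_point G L a s) y) t)\<^sup>2)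
        = 4 * A\<^sup>2 * l^3 / 3 + 2 * A * (2 * (th - tt) / l + 1 - 2 * ((Yh - Yt) / l)) * l\<^sup>2
          + (2 * (th - tt) / l + 1 - 2 * ((Yh - Yt) / l))\<^sup>2 * l"
      by simp
    also note linear_energy_identity[OF l, of tt th hh Yh Yt, folded A_def]
    moreover have "(case y of Vertex v \<Rightarrow> 0 | Inner b u \<Rightarrow>
             if a = b then interp G L (\<lambda>v. K v - Y v) y else 0) = 0"
      using False by (cases y) auto
    ultimately show ?thesis
      by (simp add: T l_def[symmetric] vdrop_def K_def Yt_def[symmetric] Yh_def[symmetric]
          tt_def[symmetric] hh_def[symmetric])
  qed
qed

text \<open>Summation by parts: the mixed terms add up to the energy of \<open>Y\<close> against
  \<open>\<phi>\<close>. As \<open>\<phi>\<close> vanishes at \<open>p\<close>, this is the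
  interpolated value of \<open>\<phi>\<close> at \<open>y\<close>, which is also the total of the
  corrections.\<close>

lemma tau_at_eq:
  assumes p: "p \<in> verts G" and g: "is_green G L p g" and y: "y \<in> points G L"
  shows "tau_at G L y
       = (\<Sum>a\<in>arcs G. (L a - transfer G g a a)\<^sup>2 / (12 * L a) + (vdrop G a (\<lambda>v. g v v))\<^sup>2 / (4 * L a))"
proof -
  define Y where "Y v = interp G L (\<lambda>w. g w v) y" for v
  define \<phi> where "\<phi> v = g v v - Y v" for v
  define D where "D a = (case y of Vertex v \<Rightarrow> 0 | Inner b u \<Rightarrow>
             if a = b then interp G L \<phi> y else 0)" for a
  have "Y p = 0"
    using y is_greenD(1)[OF g] by (cases y) (auto simp: Y_def)
  then have "\<phi> p = 0" using is_greenD(1)[OF g p] by (simp add: \<phi>_def)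
  then have dir: "(\<Sum>a\<in>arcs G. vdrop G a Y * vdrop G a \<phi> / L a) = interp G L \<phi> y"
    using dirichlet_interp[OF g y, of \<phi>] by (simp add: dirichlet_def Y_def[abs_def])
  \<comment> \<open>At a vertex \<open>v\<close> there is no correction, and \<open>\<phi> v\<close>
    is \<open>g v v - g v v\<close>.\<close>
  have D: "(\<Sum>a\<in>arcs G. D a) = interp G L \<phi> y"
  proof (cases y)
    case (Vertex v)
    then show ?thesis by (simp add: D_def \<phi>_def Y_def)
  next
    case (Inner b u)
    with y show ?thesis by (simp add: D_def Inner)
  qed
  have "4 * tau_at G L y = (\<Sum>a\<in>arcs G. (L a - transfer G g a a)\<^sup>2 / (3 * L a)
      + (vdrop G a (\<lambda>v. g v v))\<^sup>2 / L a - 4 * (vdrop G a Y * vdrop G a \<phi> / L a) + 4 * D a)"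
    unfolding tau_at_def using edge_integral[OF g y, folded Y_def \<phi>_def, folded D_def] by simp
  also have "\<dots> = (\<Sum>a\<in>arcs G. (L a - transfer G g a a)\<^sup>2 / (3 * L a) + (vdrop G a (\<lambda>v. g v v))\<^sup>2 / L a)
      - 4 * (\<Sum>a\<in>arcs G. vdrop G a Y * vdrop G a \<phi> / L a) + 4 * (\<Sum>a\<in>arcs G. D a)"
    by (simp add: sum.distrib sum_subtractf sum_distrib_left)
  also have "\<dots> = 4 * (\<Sum>a\<in>arcs G. (L a - transfer G g a a)\<^sup>2 / (12 * L a)
      + (vdrop G a (\<lambda>v. g v v))\<^sup>2 / (4 * L a))"
    unfolding dir D by (simp add: sum_distrib_left distrib_left)
  finally show ?thesis by simp
qed

text \<open>The right side does not mention the base point, so the definite description is met; the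
  point \<open>Vertex p\<close> pins its value down.\<close>

lemma tau_eq:
  assumes p: "p \<in> verts G" and g: "is_green G L p g"
  shows "tau G L
       = (\<Sum>a\<in>arcs G. (L a - transfer G g a a)\<^sup>2 / (12 * L a) + (vdrop G a (\<lambda>v. g v v))\<^sup>2 / (4 * L a))"
  unfolding tau_def
proof (rule the_equality)
  fix c assume "\<forall>y\<in>points G L. tau_at G L y = c"
  then have "tau_at G L (Vertex p) = c" using p by simp
  then show "c = (\<Sum>a\<in>arcs G. (L a - transfer G g a a)\<^sup>2 / (12 * L a)
      + (vdrop G a (\<lambda>v. g v v))\<^sup>2 / (4 * L a))"
    using tau_at_eq[OF p g, of "Vertex p"] p by simp
qed (use tau_at_eq[OF p g] in blast)

end

section \<open>Edge deletion as a rank-one perturbation\<close>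

section \<open>Deleting an edge\<close>

lemma vdrop_square: "vdrop G a (\<lambda>v. (f v)\<^sup>2) = vdrop G a f * (f (tail G a) + f (head G a))"
  by (simp add: vdrop_def power2_eq_square algebra_simps)

text \<open>Written in the sum and difference of the end values, the two quantities in which the
  deletion formula is expressed.\<close>

lemma vdrop_cube:
  "vdrop G a (\<lambda>v. (f v)^3)
     = vdrop G a f * (3 * (f (tail G a) + f (head G a))\<^sup>2 + (vdrop G a f)\<^sup>2) / 4"
  by (simp add: vdrop_def power2_eq_square power3_eq_cube algebra_simps)

lemma vdrop_del_arc [simp]: "vdrop (pre_digraph.del_arc G e) = vdrop G"
  by (intro ext) (simp add: vdrop_def pre_digraph.del_arc_simps)

lemma dipole_del_arc [simp]: "dipole (pre_digraph.del_arc G e) = dipole G"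
  by (intro ext) (simp add: dipole_def pre_digraph.del_arc_simps)

context metrized_graph
begin

lemma dirichlet_dipole:
  assumes "is_green G L p g" "a \<in> arcs G"
  shows "dirichlet G L (dipole G g a) h = vdrop G a h"
  using assms unfolding dipole_def[abs_def] dirichlet_diff by (simp add: is_greenD vdrop_def)

text \<open>Reciprocity: both sides are the mutual energy of the two dipole potentials.\<close>

lemma transfer_sym:
  assumes "is_green G L p g" "a \<in> arcs G" "b \<in> arcs G"
  shows "transfer G g a b = transfer G g b a"
  unfolding transfer_def
  using dirichlet_dipole[OF assms(1,2)] dirichlet_dipole[OF assms(1,3)] dirichlet_commute
  by metis

lemma vdrop_green:
  assumes "is_green G L p g" "a \<in> arcs G" "v \<in> verts G"
  shows "vdrop G a (g v) = dipole G g a v"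
  using is_green_sym[OF assms(1)] assms(2,3) by (simp add: vdrop_def dipole_def)

text \<open>By reciprocity the left side is the energy of the dipole potential of
  \<open>b\<close>.\<close>

lemma sum_transfer_square:
  assumes "is_green G L p g" "b \<in> arcs G"
  shows "(\<Sum>a\<in>arcs G. (transfer G g a b)\<^sup>2 / L a) = transfer G g b b"
proof -
  have "(\<Sum>a\<in>arcs G. (transfer G g a b)\<^sup>2 / L a) = dirichlet G L (dipole G g b) (dipole G g b)"
    unfolding dirichlet_def using transfer_sym[OF assms(1) _ assms(2)]
    by (intro sum.cong) (simp_all add: transfer_def power2_eq_square)
  then show ?thesis by (simp add: dirichlet_dipole[OF assms] transfer_def)
qed

lemma sum_dipole_square:
  assumes "is_green G L p g" "v \<in> verts G"
  shows "(\<Sum>a\<in>arcs G. (dipole G g a v)\<^sup>2 / L a) = g v v"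
proof -
  have "(\<Sum>a\<in>arcs G. (dipole G g a v)\<^sup>2 / L a) = dirichlet G L (g v) (g v)"
    unfolding dirichlet_def
    by (intro sum.cong) (simp_all add: vdrop_green[OF assms(1) _ assms(2)] power2_eq_square)
  then show ?thesis by (simp add: is_greenD[OF assms])
qed

text \<open>Foster's theorem: both sides are the trace of the Laplacian composed with \<open>g\<close>.\<close>

lemma sum_transfer_self:
  assumes p: "p \<in> verts G" and g: "is_green G L p g"
  shows "(\<Sum>a\<in>arcs G. transfer G g a a / L a) = real (card (verts G)) - 1"
proof -
  note pick = sum_mult_of_bool_pick(1)[OF finite_verts]
  have "(\<Sum>v\<in>verts G. dirichlet G L (g v) (\<lambda>w. of_bool (w = v))) = (\<Sum>v\<in>verts G. 1 - 1 * of_bool (p = v))"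
    by (intro sum.cong) (simp_all add: is_greenD[OF g])
  also have "\<dots> = real (card (verts G)) - 1"
    unfolding sum_subtractf pick[OF p] by simp
  finally have *: "(\<Sum>v\<in>verts G. dirichlet G L (g v) (\<lambda>w. of_bool (w = v))) = \<dots>" .
  have "(\<Sum>v\<in>verts G. dirichlet G L (g v) (\<lambda>w. of_bool (w = v)))
      = (\<Sum>a\<in>arcs G. (\<Sum>v\<in>verts G. vdrop G a (g v) * vdrop G a (\<lambda>w. of_bool (w = v))) / L a)"
    unfolding dirichlet_def by (subst sum.swap) (simp add: sum_divide_distrib)
  also have "\<dots> = (\<Sum>a\<in>arcs G. transfer G g a a / L a)"
  proof (intro sum.cong refl)
    fix a assume a: "a \<in> arcs G"
    have "(\<Sum>v\<in>verts G. vdrop G a (g v) * vdrop G a (\<lambda>w. of_bool (w = v)))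
        = (\<Sum>v\<in>verts G. vdrop G a (g v) * of_bool (tail G a = v))
          - (\<Sum>v\<in>verts G. vdrop G a (g v) * of_bool (head G a = v))"
      unfolding sum_subtractf[symmetric]
      by (intro sum.cong) (simp_all add: vdrop_def[of G a "\<lambda>w. of_bool (w = _)"] right_diff_distrib)
    also have "\<dots> = transfer G g a a"
      using a by (simp only: pick tail_in_verts head_in_verts)
        (simp add: transfer_def dipole_def vdrop_def)
    finally show "(\<Sum>v\<in>verts G. vdrop G a (g v) * vdrop G a (\<lambda>w. of_bool (w = v))) / L a
        = transfer G g a a / L a" by simp
  qed
  finally show ?thesis using * by simp
qed

text \<open>Foster's theorem subtracted from the number of edges.\<close>

lemma genus_eq:
  assumes p: "p \<in> verts G" and g: "is_green G L p g"
  shows "of_int (genus G) = (\<Sum>a\<in>arcs G. (L a - transfer G g a a) / L a)"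
proof -
  have "(\<Sum>a\<in>arcs G. (L a - transfer G g a a) / L a) = (\<Sum>a\<in>arcs G. 1 - transfer G g a a / L a)"
    using length_pos by (intro sum.cong) (force simp: diff_divide_distrib)+
  then show ?thesis
    by (simp add: sum_subtractf sum_transfer_self[OF p g] genus_def)
qed

lemma dirichlet_del_arc:
  assumes "e \<in> arcs G"
  shows "dirichlet (del_arc e) L f h = dirichlet G L f h - vdrop G e f * vdrop G e h / L e"
  using assms by (simp add: dirichlet_def sum_diff1)

text \<open>The Sherman--Morrison update of the Green function.\<close>

lemma is_green_del_arc:
  assumes g: "is_green G L p g" and p: "p \<in> verts G" and e: "e \<in> arcs G"
    and D: "L e - transfer G g e e \<noteq> 0"
  shows "is_green (del_arc e) L p
    (\<lambda>v w. g v w + dipole G g e v / (L e - transfer G g e e) * dipole G g e w)"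
proof -
  define c where "c v = dipole G g e v / (L e - transfer G g e e)" for v
  have "dipole G g e p = 0"
    using e is_greenD(1)[OF g] by (simp add: dipole_def)
  moreover have "dirichlet (del_arc e) L (\<lambda>w. g v w + c v * dipole G g e w) h = h v - h p"
    if v: "v \<in> verts G" for v h
  proof -
    have "dirichlet (del_arc e) L (\<lambda>w. g v w + c v * dipole G g e w) h
        = h v - h p + c v * vdrop G e h
          - (dipole G g e v + c v * transfer G g e e) * vdrop G e h / L e"
      unfolding dirichlet_del_arc[OF e] dirichlet_add dirichlet_cmult vdrop_add vdrop_cmult
      by (simp add: is_greenD[OF g v] dirichlet_dipole[OF g e] vdrop_green[OF g e v] transfer_def
          add_divide_distrib distrib_right right_diff_distrib)
    \<comment> \<open>This equation determines \<open>c v\<close>: with it the term lost by deleting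
      \<open>e\<close> cancels the one added by the dipole.\<close>
    moreover have "dipole G g e v + c v * transfer G g e e = c v * L e"
      using D by (simp add: c_def field_simps)
    ultimately show ?thesis using length_pos[OF e] by simp
  qed
  ultimately show ?thesis
    using is_greenD(1)[OF g] by (simp add: is_green_def c_def)
qed

lemma metrized_graph_del_arc:
  assumes "Digraph_Component.connected (del_arc e)"
  shows "metrized_graph (del_arc e) L"
proof -
  interpret H: fin_digraph "del_arc e" by (rule fin_digraph_del_arc)
  show ?thesis by unfold_locales (use assms length_pos in auto)
qed

text \<open>The parallel law for the resistors \<open>L e\<close> and \<open>edge_R G L e\<close>,
  in product form.\<close>

lemma edge_R_relation:
  assumes g: "is_green G L p g" and p: "p \<in> verts G" and e: "e \<in> arcs G"
    and conn: "Digraph_Component.connected (del_arc e)"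
  shows "edge_R G L e \<ge> 0" "transfer G g e e * (L e + edge_R G L e) = L e * edge_R G L e"
proof -
  interpret H: metrized_graph "del_arc e" L by (rule metrized_graph_del_arc[OF conn])
  obtain g' where g': "is_green (del_arc e) L p g'"
    using H.ex_green[of p] p by auto
  define f where "f = dipole G g' e"
  have f: "dirichlet (del_arc e) L f h = vdrop G e h" for h
    using is_greenD(2)[OF g'] e unfolding f_def dipole_def[abs_def] dirichlet_diff
    by (simp add: vdrop_def)
  have R: "edge_R G L e = vdrop G e f"
    unfolding edge_R_def vdrop_def
    by (rule H.eff_resistance_eqI) (use e f in \<open>auto simp: vdrop_def\<close>)
  have "0 \<le> dirichlet (del_arc e) L f f"
    unfolding dirichlet_def using length_pos by (intro sum_nonneg) (auto intro!: divide_nonneg_pos)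
  then show "edge_R G L e \<ge> 0" by (simp add: f R)
  \<comment> \<open>The mutual energy of the dipole potentials of \<open>e\<close> before and after
    deletion, first through the deletion formula; the dipole property in \<open>G\<close> then
    evaluates it a second time.\<close>
  have "dirichlet G L f (dipole G g e)
      = vdrop G e (dipole G g e) + vdrop G e f * vdrop G e (dipole G g e) / L e"
    using f[of "dipole G g e"] by (simp add: dirichlet_del_arc[OF e])
  then have "edge_R G L e = transfer G g e e + edge_R G L e * transfer G g e e / L e"
    using dirichlet_dipole[OF g e, of f] by (simp add: dirichlet_commute R transfer_def)
  then show "transfer G g e e * (L e + edge_R G L e) = L e * edge_R G L e"
    using length_pos[OF e] by (simp add: field_simps)
qed

lemma edge_R_transfer:
  assumes "is_green G L p g" "p \<in> verts G" and e: "e \<in> arcs G"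
    and "Digraph_Component.connected (del_arc e)"
  shows "L e - transfer G g e e > 0"
    and "L e / (L e + edge_R G L e) = (L e - transfer G g e e) / L e"
    and "L e * edge_R G L e / (L e + edge_R G L e) = transfer G g e e"
proof -
  note R = edge_R_relation[OF assms]
  have pos: "L e + edge_R G L e > 0" using R(1) length_pos[OF e] by simp
  then have T: "transfer G g e e = L e * edge_R G L e / (L e + edge_R G L e)"
    using R(2) by (simp add: field_simps)
  then show "L e * edge_R G L e / (L e + edge_R G L e) = transfer G g e e" by simp
  have D: "L e - transfer G g e e = L e * (L e / (L e + edge_R G L e))"
    using pos by (simp add: T field_simps)
  show "L e - transfer G g e e > 0"
    unfolding D using pos length_pos[OF e] by simp
  show "L e / (L e + edge_R G L e) = (L e - transfer G g e e) / L e"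
    unfolding D using length_pos[OF e] by simp
qed

text \<open>\<open>tau_eq\<close> for the updated Green function, still grounded at
  \<open>p\<close>. The update adds a multiple of the dipole square to the diagonal of
  \<open>g\<close>, whose drop factors as difference times sum of the end values.\<close>

lemma tau_del_arc:
  assumes g: "is_green G L p g" and p: "p \<in> verts G" and e: "e \<in> arcs G"
    and conn: "Digraph_Component.connected (del_arc e)"
  defines "D \<equiv> L e - transfer G g e e"
  shows "tau (del_arc e) L = (\<Sum>f\<in>arcs G - {e}.
      (L f - transfer G g f f - (transfer G g e f)\<^sup>2 / D)\<^sup>2 / (12 * L f)
      + (vdrop G f (\<lambda>v. g v v)
          + transfer G g e f * (dipole G g e (tail G f) + dipole G g e (head G f)) / D)\<^sup>2 / (4 * L f))"
proof -
  interpret H: metrized_graph "del_arc e" L by (rule metrized_graph_del_arc[OF conn])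
  define g' where "g' v w = g v w + dipole G g e v / D * dipole G g e w" for v w
  have "D \<noteq> 0" using edge_R_transfer(1)[OF g p e conn] by (simp add: D_def)
  then have g': "is_green (del_arc e) L p g'"
    using is_green_del_arc[OF g p e] by (simp add: D_def g'_def[abs_def])
  have T: "transfer (del_arc e) g' f f = transfer G g f f + (transfer G g e f)\<^sup>2 / D"
    if f: "f \<in> arcs G" for f
  proof -
    have "dipole G g' f = (\<lambda>v. dipole G g f v + (transfer G g e f / D) * dipole G g e v)"
      by (rule ext) (simp add: dipole_def g'_def transfer_def vdrop_def diff_divide_distrib
          add_divide_distrib algebra_simps)
    then have "vdrop G f (dipole G g' f)
        = transfer G g f f + transfer G g e f / D * transfer G g e f"
      by (simp only: transfer_def vdrop_add vdrop_cmult)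
    then show ?thesis
      by (simp add: transfer_def[of "del_arc e"] power2_eq_square)
  qed
  have K: "vdrop G f (\<lambda>v. g' v v) = vdrop G f (\<lambda>v. g v v)
      + transfer G g e f * (dipole G g e (tail G f) + dipole G g e (head G f)) / D" for f
  proof -
    have "(\<lambda>v. g' v v) = (\<lambda>v. g v v + 1 / D * (dipole G g e v)\<^sup>2)"
      by (rule ext) (simp add: g'_def power2_eq_square)
    then have "vdrop G f (\<lambda>v. g' v v)
        = vdrop G f (\<lambda>v. g v v) + 1 / D * vdrop G f (\<lambda>v. (dipole G g e v)\<^sup>2)"
      by (simp only: vdrop_add vdrop_cmult)
    then show ?thesis by (simp add: vdrop_square transfer_def)
  qed
  have "tau (del_arc e) L = (\<Sum>f\<in>arcs G - {e}.
      (L f - transfer (del_arc e) g' f f)\<^sup>2 / (12 * L f) + (vdrop G f (\<lambda>v. g' v v))\<^sup>2 / (4 * L f))"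
    using H.tau_eq[OF _ g'] p by simp
  then show ?thesis by (simp add: T K diff_diff_eq)
qed

end

section \<open>Summing the deletion formula over all edges\<close>

section \<open>The deletion identity\<close>

context metrized_graph
begin

text \<open>\<open>cycle_form g e f / sqrt (L e * L f)\<close> is the matrix of the orthogonal projection onto the
  cycle space.\<close>

definition cycle_form :: "('v \<Rightarrow> 'v \<Rightarrow> real) \<Rightarrow> 'e \<Rightarrow> 'e \<Rightarrow> real" where
  "cycle_form g e f = (if e = f then L e else 0) - transfer G g e f"

text \<open>The factor that accompanies \<open>transfer\<close> when the drop of a squared dipole
  potential is factored.\<close>

definition dipole_sum :: "('v \<Rightarrow> 'v \<Rightarrow> real) \<Rightarrow> 'e \<Rightarrow> 'e \<Rightarrow> real" where
  "dipole_sum g e f = dipole G g e (tail G f) + dipole G g e (head G f)"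

lemma sum_if_eq_split:
  assumes "e \<in> arcs G"
  shows "(\<Sum>f\<in>arcs G. (if f = e then A f else B f))
       = (\<Sum>f\<in>arcs G. B f) + (A e - B e :: real)"
  using assms by (simp add: sum.remove[of _ e])

text \<open>By symmetry of \<open>g\<close> the mixed tail-head terms cancel.\<close>

lemma vdrop_diagonal:
  assumes "is_green G L p g" "f \<in> arcs G"
  shows "vdrop G f (\<lambda>v. g v v) = dipole_sum g f f"
  using is_green_sym[OF assms(1), of "tail G f" "head G f"] assms(2)
  by (simp add: vdrop_def dipole_sum_def dipole_def)

text \<open>Idempotence of the cycle projection, read on the diagonal; it follows from
  \<open>sum_transfer_square\<close> by correcting the single term \<open>e = f\<close>.\<close>

lemma sum_cycle_form_square:
  assumes g: "is_green G L p g" and f: "f \<in> arcs G"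
  shows "(\<Sum>e\<in>arcs G. (cycle_form g e f)\<^sup>2 / L e) = cycle_form g f f"
proof -
  have "(\<Sum>e\<in>arcs G. (cycle_form g e f)\<^sup>2 / L e)
      = (\<Sum>e\<in>arcs G. if e = f then (L e - transfer G g e f)\<^sup>2 / L e else (transfer G g e f)\<^sup>2 / L e)"
    by (intro sum.cong) (auto simp: cycle_form_def)
  also have "\<dots> = transfer G g f f
      + ((L f - transfer G g f f)\<^sup>2 / L f - (transfer G g f f)\<^sup>2 / L f)"
    by (simp only: sum_if_eq_split[OF f] sum_transfer_square[OF g f])
  also have "\<dots> = cycle_form g f f"
    using length_pos[OF f] by (simp add: cycle_form_def field_simps power2_eq_square)
  finally show ?thesis .
qed

text \<open>A transfer times a dipole sum is a difference of squared potentials, so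
  \<open>sum_dipole_square\<close> evaluates the transfer part as the drop of the diagonal of
  \<open>g\<close>. The term \<open>L f\<close> at \<open>e = f\<close> cancels it.\<close>

lemma sum_cycle_form_dipole_sum:
  assumes g: "is_green G L p g" and f: "f \<in> arcs G"
  shows "(\<Sum>e\<in>arcs G. cycle_form g e f * dipole_sum g e f / L e) = 0"
proof -
  have "(\<Sum>e\<in>arcs G. transfer G g e f * dipole_sum g e f / L e)
      = (\<Sum>e\<in>arcs G. (dipole G g e (tail G f))\<^sup>2 / L e - (dipole G g e (head G f))\<^sup>2 / L e)"
    by (intro sum.cong refl)
      (simp add: transfer_def vdrop_def dipole_sum_def power2_eq_square algebra_simps
        diff_divide_distrib)
  also have "\<dots> = vdrop G f (\<lambda>v. g v v)"
    using f by (simp add: sum_subtractf sum_dipole_square[OF g] vdrop_def)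
  finally have T: "(\<Sum>e\<in>arcs G. transfer G g e f * dipole_sum g e f / L e) = dipole_sum g f f"
    by (simp add: vdrop_diagonal[OF g f])
  have "(\<Sum>e\<in>arcs G. cycle_form g e f * dipole_sum g e f / L e)
      = (\<Sum>e\<in>arcs G. if e = f then (L e - transfer G g e f) * dipole_sum g e f / L e
          else - (transfer G g e f * dipole_sum g e f / L e))"
    by (intro sum.cong) (auto simp: cycle_form_def)
  also have "\<dots> = 0"
    unfolding sum_if_eq_split[OF f] sum_negf T
    using length_pos[OF f] by (simp add: field_simps)
  finally show ?thesis .
qed

text \<open>The cube of the dipole potential is tested against the dipole current.\<close>

lemma sum_cycle_form_quartic:
  assumes g: "is_green G L p g" and e: "e \<in> arcs G"
  shows "(\<Sum>f\<in>arcs G. (cycle_form g e f)\<^sup>2 * (3 * (dipole_sum g e f)\<^sup>2 + (cycle_form g e f)\<^sup>2) / L f)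
       = cycle_form g e e * (3 * (dipole_sum g e e)\<^sup>2
           + (L e)\<^sup>2 - 3 * cycle_form g e e * L e + 3 * (cycle_form g e e)\<^sup>2)"
proof -
  define T where "T f = transfer G g e f" for f
  define S where "S f = dipole_sum g e f" for f
  have cube: "vdrop G f (\<lambda>v. (dipole G g e v)^3) = T f * (3 * (S f)\<^sup>2 + (T f)\<^sup>2) / 4" for f
    by (simp add: vdrop_cube T_def S_def transfer_def dipole_sum_def)
  have "(\<Sum>f\<in>arcs G. (T f)\<^sup>2 * (3 * (S f)\<^sup>2 + (T f)\<^sup>2) / L f)
      = 4 * dirichlet G L (dipole G g e) (\<lambda>v. (dipole G g e v)^3)"
    unfolding dirichlet_def cube sum_distrib_left
    by (intro sum.cong) (simp_all add: T_def transfer_def power2_eq_square)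
  also have "\<dots> = T e * (3 * (S e)\<^sup>2 + (T e)\<^sup>2)"
    by (simp add: dirichlet_dipole[OF g e] cube)
  finally have quartic: "(\<Sum>f\<in>arcs G. (T f)\<^sup>2 * (3 * (S f)\<^sup>2 + (T f)\<^sup>2) / L f) = \<dots>" .
  have "(\<Sum>f\<in>arcs G. (cycle_form g e f)\<^sup>2 * (3 * (S f)\<^sup>2 + (cycle_form g e f)\<^sup>2) / L f)
      = (\<Sum>f\<in>arcs G. if f = e then (L f - T f)\<^sup>2 * (3 * (S f)\<^sup>2 + (L f - T f)\<^sup>2) / L f
          else (T f)\<^sup>2 * (3 * (S f)\<^sup>2 + (T f)\<^sup>2) / L f)"
    by (intro sum.cong) (auto simp: cycle_form_def T_def)
  \<comment> \<open>Only the term \<open>f = e\<close> differs from the sum for transfers; the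
    result is rewritten through \<open>L e - T e\<close>, the diagonal entry of
    \<open>cycle_form\<close>.\<close>
  also have "\<dots> = (L e - T e) * (3 * (S e)\<^sup>2 + (L e)\<^sup>2 - 3 * (L e - T e) * L e + 3 * (L e - T e)\<^sup>2)"
    unfolding sum_if_eq_split[OF e] quartic
    using length_pos[OF e] by (simp add: field_simps) algebra
  finally show ?thesis
    by (simp add: cycle_form_def T_def S_def)
qed

text \<open>The summand vanishes for \<open>f = e\<close>, so that the sum can range over all edges.\<close>

lemma weighted_tau_del_arc:
  assumes g: "is_green G L p g" and p: "p \<in> verts G" and e: "e \<in> arcs G"
    and conn: "Digraph_Component.connected (del_arc e)"
  defines "X \<equiv> cycle_form g" and "S \<equiv> dipole_sum g"
  shows "L e / (L e + edge_R G L e) * tau (del_arc e) L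
       = (\<Sum>f\<in>arcs G. X e e / L e * ((X f f)\<^sup>2 / (12 * L f) + (S f f)\<^sup>2 / (4 * L f))
            - X f f / (6 * L f) * ((X e f)\<^sup>2 / L e)
            - S f f / (2 * L f) * (X e f * S e f / L e)
            + 1 / (12 * L e * X e e) * ((X e f)\<^sup>2 * (3 * (S e f)\<^sup>2 + (X e f)\<^sup>2) / L f))"
    (is "_ = (\<Sum>f\<in>arcs G. ?W f)")
proof -
  have D: "X e e > 0" "L e / (L e + edge_R G L e) = X e e / L e"
    using edge_R_transfer(1,2)[OF g p e conn] by (simp_all add: X_def cycle_form_def)
  have Le: "L e > 0" using length_pos[OF e] .
  \<comment> \<open>Off the diagonal \<open>cycle_form\<close> is minus the transfer: squares are
    unchanged, while the sign in front of the dipole sum flips.\<close>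
  have "tau (del_arc e) L = (\<Sum>f\<in>arcs G - {e}.
      (X f f - (X e f)\<^sup>2 / X e e)\<^sup>2 / (12 * L f) + (S f f - X e f * S e f / X e e)\<^sup>2 / (4 * L f))"
    unfolding tau_del_arc[OF g p e conn]
    by (intro sum.cong) (auto simp: X_def S_def cycle_form_def vdrop_diagonal[OF g] dipole_sum_def)
  then have "L e / (L e + edge_R G L e) * tau (del_arc e) L = (\<Sum>f\<in>arcs G - {e}. X e e / L e *
      ((X f f - (X e f)\<^sup>2 / X e e)\<^sup>2 / (12 * L f) + (S f f - X e f * S e f / X e e)\<^sup>2 / (4 * L f)))"
    by (simp add: D(2) sum_distrib_left)
  also have "\<dots> = (\<Sum>f\<in>arcs G - {e}. ?W f)"
  proof (intro sum.cong refl)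
    fix f assume "f \<in> arcs G - {e}"
    then have "L f > 0" using length_pos by simp
    with Le D(1) show "X e e / L e *
      ((X f f - (X e f)\<^sup>2 / X e e)\<^sup>2 / (12 * L f) + (S f f - X e f * S e f / X e e)\<^sup>2 / (4 * L f)) = ?W f"
      by (simp add: divide_simps power2_eq_square) algebra
  qed
  also have "\<dots> = (\<Sum>f\<in>arcs G. ?W f)"
  proof -
    \<comment> \<open>For \<open>f = e\<close> both squares in the unexpanded summand have base
      zero.\<close>
    have "?W e = 0"
      using Le D(1) by (simp add: divide_simps power2_eq_square) algebra
    then show ?thesis using e by (simp add: sum.remove[of _ e])
  qed
  finally show ?thesis .
qed

text \<open>Of the four double sums, the first factors as the genus times tau, the second is
  evaluated by the projection property and the third vanishes. The second and the quartic fourth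
  together give one more copy of tau, whence the factor genus plus 1, along with the length and
  resistance terms.\<close>

lemma sum_weighted_tau_del_arc:
  assumes br: "bridgeless G" and g: "is_green G L p g" and p: "p \<in> verts G"
  shows "(\<Sum>a\<in>arcs G. L a / (L a + edge_R G L a) * tau (del_arc a) L)
       = (of_int (genus G) + 1) * tau G L - total_length G L / 6 + r_const G L / 4"
proof -
  define X where "X = cycle_form g"
  define S where "S = dipole_sum g"
  define q where "q f = (X f f)\<^sup>2 / (12 * L f) + (S f f)\<^sup>2 / (4 * L f)" for f
  have conn: "Digraph_Component.connected (del_arc e)" if "e \<in> arcs G" for e
    using br that by (simp add: bridgeless_def)
  have X_pos: "X e e > 0" if "e \<in> arcs G" for e
    using edge_R_transfer(1)[OF g p that conn[OF that]] by (simp add: X_def cycle_form_def)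
  have X_self: "X e e = L e - transfer G g e e" for e by (simp add: X_def cycle_form_def)
  have tau: "tau G L = (\<Sum>f\<in>arcs G. q f)"
    unfolding tau_eq[OF p g] by (simp add: vdrop_diagonal[OF g] X_self q_def S_def)
  have gen: "(\<Sum>e\<in>arcs G. X e e / L e) = of_int (genus G)"
    unfolding genus_eq[OF p g] X_self ..
  have r: "r_const G L = (\<Sum>e\<in>arcs G. L e - X e e)"
    unfolding r_const_def X_self using edge_R_transfer(3)[OF g p _ conn] by simp
  have "(\<Sum>e\<in>arcs G. L e / (L e + edge_R G L e) * tau (del_arc e) L)
      = (\<Sum>e\<in>arcs G. \<Sum>f\<in>arcs G. X e e / L e * q f
            - X f f / (6 * L f) * ((X e f)\<^sup>2 / L e)
            - S f f / (2 * L f) * (X e f * S e f / L e)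
            + 1 / (12 * L e * X e e) * ((X e f)\<^sup>2 * (3 * (S e f)\<^sup>2 + (X e f)\<^sup>2) / L f))"
    unfolding q_def X_def S_def using weighted_tau_del_arc[OF g p _ conn] by simp
  also have "\<dots> = (\<Sum>e\<in>arcs G. X e e / L e) * (\<Sum>f\<in>arcs G. q f)
      - (\<Sum>f\<in>arcs G. X f f / (6 * L f) * (\<Sum>e\<in>arcs G. (X e f)\<^sup>2 / L e))
      - (\<Sum>f\<in>arcs G. S f f / (2 * L f) * (\<Sum>e\<in>arcs G. X e f * S e f / L e))
      + (\<Sum>e\<in>arcs G. 1 / (12 * L e * X e e)
          * (\<Sum>f\<in>arcs G. (X e f)\<^sup>2 * (3 * (S e f)\<^sup>2 + (X e f)\<^sup>2) / L f))"
  proof -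
    have 1: "(\<Sum>f\<in>arcs G. X f f / (6 * L f) * (\<Sum>e\<in>arcs G. (X e f)\<^sup>2 / L e))
        = (\<Sum>e\<in>arcs G. \<Sum>f\<in>arcs G. X f f / (6 * L f) * ((X e f)\<^sup>2 / L e))"
      unfolding sum_distrib_left by (rule sum.swap)
    have 2: "(\<Sum>f\<in>arcs G. S f f / (2 * L f) * (\<Sum>e\<in>arcs G. X e f * S e f / L e))
        = (\<Sum>e\<in>arcs G. \<Sum>f\<in>arcs G. S f f / (2 * L f) * (X e f * S e f / L e))"
      unfolding sum_distrib_left by (rule sum.swap)
    have 3: "(\<Sum>e\<in>arcs G. 1 / (12 * L e * X e e)
          * (\<Sum>f\<in>arcs G. (X e f)\<^sup>2 * (3 * (S e f)\<^sup>2 + (X e f)\<^sup>2) / L f))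
        = (\<Sum>e\<in>arcs G. \<Sum>f\<in>arcs G. 1 / (12 * L e * X e e)
          * ((X e f)\<^sup>2 * (3 * (S e f)\<^sup>2 + (X e f)\<^sup>2) / L f))"
      by (simp only: sum_distrib_left)
    show ?thesis
      unfolding 1 2 3 sum_product sum.distrib sum_subtractf ..
  qed
  also have "\<dots> = of_int (genus G) * tau G L
      - (\<Sum>f\<in>arcs G. X f f / (6 * L f) * X f f)
      + (\<Sum>e\<in>arcs G. 1 / (12 * L e * X e e)
          * (X e e * (3 * (S e e)\<^sup>2 + (L e)\<^sup>2 - 3 * X e e * L e + 3 * (X e e)\<^sup>2)))"
    using sum_cycle_form_square[OF g] sum_cycle_form_dipole_sum[OF g] sum_cycle_form_quartic[OF g]
    by (simp add: gen[unfolded X_def] tau X_def S_def)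
  also have "\<dots> = of_int (genus G) * tau G L + (\<Sum>e\<in>arcs G. q e - L e / 6 + (L e - X e e) / 4)"
  proof -
    \<comment> \<open>The positive \<open>X e e\<close> cancels in the quartic term, and what
      remains agrees edge by edge with the summand of tau plus the two linear terms.\<close>
    have "- (X e e / (6 * L e) * X e e) + 1 / (12 * L e * X e e)
          * (X e e * (3 * (S e e)\<^sup>2 + (L e)\<^sup>2 - 3 * X e e * L e + 3 * (X e e)\<^sup>2))
        = q e - L e / 6 + (L e - X e e) / 4" if "e \<in> arcs G" for e
      using length_pos[OF that] X_pos[OF that]
      by (simp add: q_def divide_simps power2_eq_square) algebra
    then have "- (\<Sum>f\<in>arcs G. X f f / (6 * L f) * X f f) + (\<Sum>e\<in>arcs G. 1 / (12 * L e * X e e)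
          * (X e e * (3 * (S e e)\<^sup>2 + (L e)\<^sup>2 - 3 * X e e * L e + 3 * (X e e)\<^sup>2)))
        = (\<Sum>e\<in>arcs G. q e - L e / 6 + (L e - X e e) / 4)"
      unfolding sum_negf[symmetric] sum.distrib[symmetric] by (intro sum.cong) auto
    then show ?thesis by linarith
  qed
  also have "\<dots> = (of_int (genus G) + 1) * tau G L - total_length G L / 6 + r_const G L / 4"
    by (simp add: sum.distrib sum_subtractf tau r total_length_def distrib_right
        flip: sum_divide_distrib)
  finally show ?thesis .
qed

end

section \<open>Solving the summed identity for tau\<close>

theorem theorem3p6:
  fixes G :: "('v, 'e) pre_digraph" and L :: "'e \<Rightarrow> real"
  assumes "metrized_graph G L"
    and "bridgeless G"
  shows "tau G L =
      1 / (of_int (genus G) + 1) *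
        (\<Sum>a \<in> arcs G. L a / (L a + edge_R G L a) * tau (pre_digraph.del_arc G a) L)
      + total_length G L / (6 * (of_int (genus G) + 1))
      - r_const G L / (4 * (of_int (genus G) + 1))"
proof -
  interpret metrized_graph G L by fact
  obtain p where p: "p \<in> verts G"
    using connected by (auto simp: connected_def strongly_connected_def)
  obtain g where g: "is_green G L p g" using ex_green[OF p] by blast
  \<comment> \<open>Bridgelessness makes every summand in \<open>genus_eq\<close> positive, so the
    genus is nonnegative and division by genus plus 1 is legitimate.\<close>
  have "0 \<le> (of_int (genus G) :: real)"
    unfolding genus_eq[OF p g]
    using edge_R_transfer(1)[OF g p] assms(2) length_pos
    by (intro sum_nonneg) (auto simp: bridgeless_def intro!: divide_nonneg_pos less_imp_le)
  then have "(of_int (genus G) :: real) + 1 \<noteq> 0" by linarith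
  moreover have "t = 1 / c * (c * t - l / 6 + r / 4) + l / (6 * c) - r / (4 * c)"
    if "c \<noteq> 0" for c t l r :: real
    using that by (simp add: field_simps)
  ultimately show ?thesis
    unfolding sum_weighted_tau_del_arc[OF assms(2) g p] by blast
qed

end
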